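(* Let $\mathbb{L}$ be a finite-dimensional semisimple Lie algebra over $\mathbb{F}$ with maximal torus $H$ and root system $\Phi$, and let $L=H\oplus\bigoplus_{\alpha\in\Psi}L_\alpha$ ($\Psi\subseteq\Phi$) be any minimal $Q$-graded subalgebra of $\mathbb{L}$. Set $I=[L,L]=\bigoplus_{\alpha\in\Psi}L_\alpha$. Then $I$ is abelian (that is, $L$ is metabelian).
   Context: $\mathbb{F}$ is an algebraically closed field of characteristic $0$; $\mathbb{L}$ is a finite-dimensional semisimple Lie algebra over $\mathbb{F}$; $H$ is a fixed maximal torus, $\Phi\subset H^*$ the corresponding root system, and $\mathbb{L}=H\oplus\bigoplus_{\alpha\in\Phi}L_\alpha$ the root space decomposition. Put $Q=\mathbb{Z}\Phi$ (the root lattice). Definition. A subalgebra $L$ of $\mathbb{L}$ containing $H$ has the form $L=H\oplus\bigoplus_{\alpha\in\Psi}L_\alpha$ with $\Psi\subseteq\Phi$. It is called a $Q$-graded subalgebra if $Q=\mathrm{span}_{\mathbb{Z}}\Psi$. A $Q$-graded subalgebra $L$ is called minimal if there is no $Q$-graded subalgebra $L_1$ of $\mathbb{L}$ with $L_1\subsetneq L$. *)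

theory Defs
  imports Complex_Main "HOL-Computational_Algebra.Polynomial"
begin

section \<open>Lie algebras\<close>

locale lie_algebra = vector_space scale
  for scale :: "'k::field \<Rightarrow> 'a::ab_group_add \<Rightarrow> 'a" (infixr \<open>*s\<close> 75) +
  fixes bracket :: "'a \<Rightarrow> 'a \<Rightarrow> 'a"
  assumes bracket_add_left: "bracket (x + y) z = bracket x z + bracket y z"
    and bracket_add_right: "bracket x (y + z) = bracket x y + bracket x z"
    and bracket_scale_left: "bracket (c *s x) y = c *s bracket x y"
    and bracket_scale_right: "bracket x (c *s y) = c *s bracket x y"
    and bracket_self: "bracket x x = 0"
    and jacobi: "bracket x (bracket y z) + bracket y (bracket z x) + bracket z (bracket x y) = 0"
begin

definition subalgebra :: "'a set \<Rightarrow> bool" where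
  "subalgebra L \<longleftrightarrow> subspace L \<and> (\<forall>x\<in>L. \<forall>y\<in>L. bracket x y \<in> L)"

definition lie_ideal :: "'a set \<Rightarrow> bool" where
  "lie_ideal I \<longleftrightarrow> subspace I \<and> (\<forall>x. \<forall>y\<in>I. bracket x y \<in> I)"

definition commutator :: "'a set \<Rightarrow> 'a set \<Rightarrow> 'a set" where
  "commutator A B = span {bracket x y | x y. x \<in> A \<and> y \<in> B}"

definition abelian :: "'a set \<Rightarrow> bool" where
  "abelian A \<longleftrightarrow> (\<forall>x\<in>A. \<forall>y\<in>A. bracket x y = 0)"

fun derived_series :: "'a set \<Rightarrow> nat \<Rightarrow> 'a set" where
  "derived_series L 0 = L"
| "derived_series L (Suc n) = commutator (derived_series L n) (derived_series L n)"

definition solvable :: "'a set \<Rightarrow> bool" where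
  "solvable L \<longleftrightarrow> (\<exists>n. derived_series L n = {0})"

definition metabelian :: "'a set \<Rightarrow> bool" where
  "metabelian L \<longleftrightarrow> derived_series L 2 = {0}"

text \<open>Internal direct sum of a family of subspaces.\<close>

definition is_direct_sum :: "'a set \<Rightarrow> 'i set \<Rightarrow> ('i \<Rightarrow> 'a set) \<Rightarrow> bool" where
  "is_direct_sum W I U \<longleftrightarrow>
     (\<forall>i\<in>I. subspace (U i)) \<and> W = span (\<Union>i\<in>I. U i) \<and>
     (\<forall>i\<in>I. U i \<inter> span (\<Union>j\<in>I - {i}. U j) = {0})"


section \<open>Maximal tori and roots\<close>

text \<open>Over an algebraically closed field, ad-semisimple means ad-diagonalizable.\<close>

definition ad_semisimple :: "'a \<Rightarrow> bool" where
  "ad_semisimple x \<longleftrightarrow>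
     (\<exists>B. independent B \<and> span B = UNIV \<and> (\<forall>b\<in>B. \<exists>c. bracket x b = c *s b))"

definition torus :: "'a set \<Rightarrow> bool" where
  "torus T \<longleftrightarrow> subalgebra T \<and> (\<forall>x\<in>T. ad_semisimple x)"

definition maximal_torus :: "'a set \<Rightarrow> bool" where
  "maximal_torus H \<longleftrightarrow> torus H \<and> (\<forall>T. torus T \<longrightarrow> H \<subseteq> T \<longrightarrow> T = H)"

text \<open>
  A functional on \<open>H\<close> is represented by its extension by zero outside \<open>H\<close>, so that equality
  of functions is equality of functionals.
\<close>

definition dual :: "'a set \<Rightarrow> ('a \<Rightarrow> 'k) set" where
  "dual H = {f. (\<forall>x\<in>H. \<forall>y\<in>H. f (x + y) = f x + f y) \<and>
                (\<forall>c. \<forall>x\<in>H. f (c *s x) = c * f x) \<and> (\<forall>x. x \<notin> H \<longrightarrow> f x = 0)}"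

definition root_space :: "'a set \<Rightarrow> ('a \<Rightarrow> 'k) \<Rightarrow> 'a set" where
  "root_space H \<alpha> = {x. \<forall>h\<in>H. bracket h x = \<alpha> h *s x}"

definition roots :: "'a set \<Rightarrow> ('a \<Rightarrow> 'k) set" where
  "roots H = {\<alpha> \<in> dual H. \<alpha> \<noteq> (\<lambda>_. 0) \<and> root_space H \<alpha> \<noteq> {0}}"

text \<open>
  In \<open>H \<oplus> \<Oplus>\<^sub>\<alpha> L\<^sub>\<alpha>\<close> the summand \<open>H\<close> is indexed by the zero functional, which is not a root.
\<close>

definition component :: "'a set \<Rightarrow> ('a \<Rightarrow> 'k) \<Rightarrow> 'a set" where
  "component H \<alpha> = (if \<alpha> = (\<lambda>_. 0) then H else root_space H \<alpha>)"

definition root_decomposition :: "'a set \<Rightarrow> 'a set \<Rightarrow> ('a \<Rightarrow> 'k) set \<Rightarrow> bool" where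
  "root_decomposition H L \<Psi> \<longleftrightarrow>
     \<Psi> \<subseteq> roots H \<and> is_direct_sum L (insert (\<lambda>_. 0) \<Psi>) (component H)"

definition int_span :: "('a \<Rightarrow> 'k) set \<Rightarrow> ('a \<Rightarrow> 'k) set" where
  "int_span S = {(\<lambda>h. \<Sum>\<alpha>\<in>A. of_int (c \<alpha>) * \<alpha> h) | A c. finite A \<and> A \<subseteq> S}"

definition root_lattice :: "'a set \<Rightarrow> ('a \<Rightarrow> 'k) set" where
  "root_lattice H = int_span (roots H)"


section \<open>Q-graded subalgebras\<close>

definition Q_graded :: "'a set \<Rightarrow> 'a set \<Rightarrow> bool" where
  "Q_graded H L \<longleftrightarrow> subalgebra L \<and> H \<subseteq> L \<and>
     (\<exists>\<Psi>. root_decomposition H L \<Psi> \<and> int_span \<Psi> = root_lattice H)"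

definition minimal_Q_graded :: "'a set \<Rightarrow> 'a set \<Rightarrow> bool" where
  "minimal_Q_graded H L \<longleftrightarrow> Q_graded H L \<and> \<not> (\<exists>L1. Q_graded H L1 \<and> L1 \<subset> L)"

end

locale semisimple_lie_algebra = lie_algebra scale bracket
  for scale :: "'k::field \<Rightarrow> 'a::ab_group_add \<Rightarrow> 'a" and bracket +
  assumes finite_dimensional: "\<exists>B. finite B \<and> span B = UNIV"
    and semisimple: "lie_ideal I \<Longrightarrow> solvable I \<Longrightarrow> I = {0}"

end

theory Submission
  imports Defs "HOL-Library.Function_Algebras" "HOL-Library.Multiset"
begin

text \<open>
  A minimal \<open>Q\<close>-graded subalgebra corresponds to a set \<open>\<Psi>\<close> of roots that generates \<open>Q\<close>, is closed
  (\<open>[L\<^sub>\<alpha>, L\<^sub>\<beta>] \<noteq> 0\<close> and \<open>\<alpha> + \<beta> \<noteq> 0\<close> imply \<open>\<alpha> + \<beta> \<in> \<Psi>\<close>), and is minimal with these properties.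

  If \<open>\<Psi>\<close> met \<open>-\<Psi>\<close>, then discarding the negative roots (with respect to an additive functional that
  vanishes at no root) from \<open>\<Psi> \<inter> -\<Psi>\<close> would leave a smaller closed generating set.
  So \<open>\<Psi> \<inter> -\<Psi>\<close> is empty, and then no nonempty sum of elements of \<open>\<Psi>\<close> vanishes: in a shortest such
  sum all root vectors commute, hence they are highest weight vectors for the \<open>sl\<^sub>2\<close> of one summand
  \<open>\<alpha>\<close>, every summand pairs nonnegatively with the coroot of \<open>\<alpha>\<close>, and \<open>\<alpha>\<close> itself pairs positively.

  Therefore \<open>\<Psi>\<close> is well-founded under addition of elements of \<open>\<Psi>\<close>. If some bracket were nonzero,
  choose a minimal \<open>\<gamma> = \<alpha> + \<beta>\<close> with \<open>[L\<^sub>\<alpha>, L\<^sub>\<beta>] \<noteq> 0\<close>. Then \<open>\<alpha>\<close> is indecomposable, so \<open>\<Psi> - {\<alpha>}\<close> is still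
  closed, and it still generates \<open>Q\<close> because \<open>\<alpha> = \<gamma> - \<beta>\<close> and \<open>\<beta> \<noteq> \<alpha>\<close>, root spaces being one-dimensional.
\<close>

section \<open>Independent families of subspaces\<close>

text \<open>Semisimplicity is given only as the absence of nonzero solvable ideals, and a torus as a
  subalgebra of ad-diagonalizable elements. So three facts have to be derived before roots can be
  used: the Killing form is nondegenerate, a maximal torus is its own centralizer, and root spaces
  are one-dimensional. All of them rest on generalized eigenspaces and traces over an algebraically
  closed field of characteristic 0.

  The field carries no order, which is the obstacle wherever positivity enters. Cartan's criterion
  and the choice of positive roots take their order from additive maps into the rationals; such maps
  exist because the field, and the functions into it, are rational vector spaces and only finitely
  many nonzero elements have to be kept off the kernel. In the argument on vanishing sums, a
  nonnegative pairing is expressed as a natural multiple: 2 \<beta>(h) = k \<alpha>(h) with k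
  natural and \<alpha>(h) nonzero.\<close>

locale linear_space = vector_space scale
  for scale :: "'k::field \<Rightarrow> 'a::ab_group_add \<Rightarrow> 'a" (infixr \<open>*s\<close> 75)
begin

text \<open>Only finite subfamilies are tested, so the index set may be infinite: it will be the
  whole field for generalized eigenspaces and all of \<open>dual H\<close> for root spaces.\<close>

definition independent_family :: "'i set \<Rightarrow> ('i \<Rightarrow> 'a set) \<Rightarrow> bool" where
  "independent_family I U \<longleftrightarrow>
     (\<forall>A u. finite A \<longrightarrow> A \<subseteq> I \<longrightarrow> (\<forall>i\<in>A. u i \<in> U i) \<longrightarrow> (\<Sum>i\<in>A. u i) = 0 \<longrightarrow> (\<forall>i\<in>A. u i = 0))"

lemma independent_familyD:
  "\<lbrakk>independent_family I U; finite A; A \<subseteq> I; \<And>i. i \<in> A \<Longrightarrow> u i \<in> U i; (\<Sum>i\<in>A. u i) = 0; i \<in> A\<rbrakk>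
    \<Longrightarrow> u i = 0"
  unfolding independent_family_def by blast

lemma in_span_UN_sum:
  assumes "x \<in> span (\<Union>i\<in>I. U i)" and "\<And>i. i \<in> I \<Longrightarrow> subspace (U i)"
  shows "\<exists>A u. finite A \<and> A \<subseteq> I \<and> (\<forall>i\<in>A. u i \<in> U i) \<and> x = (\<Sum>i\<in>A. u i)"
  using assms(1)
proof (induction rule: span_induct_alt)
  case base
  show ?case by (rule exI[of _ "{}"]) simp
next
  case (step c x y)
  then obtain A u where A: "finite A" "A \<subseteq> I" "\<forall>i\<in>A. u i \<in> U i" "y = (\<Sum>i\<in>A. u i)" by blast
  from step obtain j where j: "j \<in> I" "x \<in> U j" by blast
  then have cx: "c *s x \<in> U j" using assms(2) subspace_scale by blast
  show ?case
  proof (cases "j \<in> A")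
    case True
    let ?u = "u(j := c *s x + u j)"
    have "c *s x + y = (\<Sum>i\<in>A. ?u i)"
      using A True by (simp add: sum.remove[of A j])
    moreover have "\<forall>i\<in>A. ?u i \<in> U i"
      using A cx True assms(2)[OF j(1)] by (auto intro: subspace_add)
    ultimately show ?thesis using A by blast
  next
    case False
    let ?u = "u(j := c *s x)"
    have "(\<Sum>i\<in>A. ?u i) = (\<Sum>i\<in>A. u i)"
      using False by (intro sum.cong) auto
    then have "c *s x + y = (\<Sum>i\<in>insert j A. ?u i)"
      using A False by simp
    moreover have "\<forall>i\<in>insert j A. ?u i \<in> U i" using A cx by auto
    moreover have "finite (insert j A)" "insert j A \<subseteq> I" using A j by auto
    ultimately show ?thesis by blast
  qed
qed

lemma independent_family_Int_span:
  assumes "independent_family I U" and "\<And>i. i \<in> I \<Longrightarrow> subspace (U i)"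
    and "J \<subseteq> I" "j \<in> I" "j \<notin> J" and x: "x \<in> U j" "x \<in> span (\<Union>i\<in>J. U i)"
  shows "x = 0"
proof -
  obtain A u where A: "finite A" "A \<subseteq> J" "\<forall>i\<in>A. u i \<in> U i" "x = (\<Sum>i\<in>A. u i)"
    using in_span_UN_sum[OF x(2)] assms(2,3) by blast
  let ?u = "u(j := - x)"
  have jA: "j \<notin> A" using A assms by blast
  have "(\<Sum>i\<in>A. ?u i) = (\<Sum>i\<in>A. u i)"
    using jA by (intro sum.cong) auto
  then have "(\<Sum>i\<in>insert j A. ?u i) = 0"
    using A jA by simp
  moreover have "?u i \<in> U i" if "i \<in> insert j A" for i
    using that A x(1) assms(2,4) by (auto intro: subspace_neg)
  ultimately have "?u j = 0"
    using independent_familyD[OF assms(1), of "insert j A" ?u j] A assms by blast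
  then show ?thesis by simp
qed

text \<open>A linear relation has finitely many terms and so touches finitely many indices, which
  reduces the claim to an induction over finite index sets. The part of a relation inside
  \<open>B j\<close> lies in \<open>U j\<close> and in the span of the other members, hence is zero,
  and both parts become trivial.\<close>

lemma independent_UN:
  assumes "independent_family I U" and sub: "\<And>i. i \<in> I \<Longrightarrow> subspace (U i)"
    and B: "\<And>i. i \<in> I \<Longrightarrow> independent (B i)" "\<And>i. i \<in> I \<Longrightarrow> B i \<subseteq> U i"
  shows "independent (\<Union>i\<in>I. B i)"
proof -
  have "independent (\<Union>i\<in>A. B i)" if "finite A" "A \<subseteq> I" for A
    using that
  proof (induction A rule: finite_induct)
    case (insert j A)
    have ind: "independent (\<Union>i\<in>A. B i)" using insert by blast
    show ?case
    proof (rule ccontr)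
      assume "\<not> ?thesis"
      then obtain S r v where S: "finite S" "S \<subseteq> B j \<union> (\<Union>i\<in>A. B i)"
        "(\<Sum>b\<in>S. r b *s b) = 0" "v \<in> S" "r v \<noteq> 0"
        unfolding dependent_explicit UN_insert by blast
      let ?T = "S \<inter> B j" and ?R = "S - B j"
      have split: "(\<Sum>b\<in>?T. r b *s b) + (\<Sum>b\<in>?R. r b *s b) = 0"
        using S by (metis inf_commute sum.Int_Diff)
      let ?x = "\<Sum>b\<in>?T. r b *s b"
      have xj: "?x \<in> U j"
        using B(2)[of j] insert.prems by (intro subspace_sum subspace_scale sub) auto
      have "?x = - (\<Sum>b\<in>?R. r b *s b)" using split by (simp add: eq_neg_iff_add_eq_0)
      moreover have "(\<Sum>b\<in>?R. r b *s b) \<in> span (\<Union>i\<in>A. U i)"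
      proof (intro span_sum span_scale span_base)
        fix b assume "b \<in> ?R"
        then obtain i where "i \<in> A" "b \<in> B i" using S(2) by blast
        then show "b \<in> (\<Union>i\<in>A. U i)" using B(2)[of i] insert.prems by blast
      qed
      ultimately have "?x \<in> span (\<Union>i\<in>A. U i)" by (simp add: span_neg)
      then have x0: "?x = 0"
        using independent_family_Int_span[OF assms(1) sub _ _ insert.hyps(2) xj] insert.prems by blast
      have "r b = 0" if "b \<in> ?T" for b
        using independentD[OF B(1)[of j], of ?T r b] x0 S(1) insert.prems that by blast
      moreover have "r b = 0" if "b \<in> ?R" for b
      proof (rule independentD[OF ind, of ?R])
        show "(\<Sum>b\<in>?R. r b *s b) = 0" using x0 split by simp
      qed (use S(1,2) that in auto)
      ultimately show False using S by blast
    qed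
  qed (simp add: independent_empty)
  note fin = this
  show ?thesis
  proof (rule ccontr)
    assume "\<not> ?thesis"
    then obtain S where S: "finite S" "S \<subseteq> (\<Union>i\<in>I. B i)" "dependent S"
      unfolding dependent_explicit by blast
    obtain F where F: "finite F" "F \<subseteq> B ` I" "S \<subseteq> \<Union>F"
      using finite_subset_Union[OF S(1,2)] by blast
    then obtain A where "A \<subseteq> I" "finite A" "F = B ` A"
      using finite_subset_image[OF F(1,2)] by blast
    with F have "finite A" "A \<subseteq> I" "S \<subseteq> (\<Union>i\<in>A. B i)" by auto
    then show False using fin S dependent_mono by blast
  qed
qed

end

section \<open>Generalized eigenspaces\<close>

context linear_space
begin

abbreviation linear_op :: "('a \<Rightarrow> 'a) \<Rightarrow> bool" where
  "linear_op \<equiv> Vector_Spaces.linear scale scale"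

lemma linear_opI:
  "\<lbrakk>\<And>x y. f (x + y) = f x + f y; \<And>c x. f (c *s x) = c *s f x\<rbrakk> \<Longrightarrow> linear_op f"
  by (simp add: Vector_Spaces.linear_iff vector_space_axioms)

lemma linear_opD:
  assumes "linear_op f"
  shows "f (x + y) = f x + f y" "f (c *s x) = c *s f x" "f 0 = 0" "f (- x) = - f x"
    "f (x - y) = f x - f y" "f (sum g A) = (\<Sum>a\<in>A. f (g a))"
proof -
  interpret Vector_Spaces.linear scale scale f by fact
  show "f (x + y) = f x + f y" "f (c *s x) = c *s f x" "f 0 = 0" "f (- x) = - f x"
    "f (x - y) = f x - f y" "f (sum g A) = (\<Sum>a\<in>A. f (g a))"
    by (rule add scale zero neg diff sum)+
qed

lemma linear_op_compose: "linear_op f \<Longrightarrow> linear_op g \<Longrightarrow> linear_op (\<lambda>x. f (g x))"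
  by (rule linear_opI) (simp_all add: linear_opD)

lemma linear_op_diff: "linear_op f \<Longrightarrow> linear_op g \<Longrightarrow> linear_op (\<lambda>x. f x - g x)"
  by (rule linear_opI) (simp_all add: linear_opD scale_right_diff_distrib)

lemma linear_op_funpow: "linear_op f \<Longrightarrow> linear_op (f ^^ n)"
  by (induction n) (auto intro!: linear_opI simp: linear_opD)

definition shift :: "('a \<Rightarrow> 'a) \<Rightarrow> 'k \<Rightarrow> 'a \<Rightarrow> 'a" where
  "shift T \<nu> v = T v - \<nu> *s v"

definition gen_eigenspace :: "('a \<Rightarrow> 'a) \<Rightarrow> 'k \<Rightarrow> 'a set" where
  "gen_eigenspace T \<nu> = {v. \<exists>n. (shift T \<nu> ^^ n) v = 0}"

definition eigenspace :: "('a \<Rightarrow> 'a) \<Rightarrow> 'k \<Rightarrow> 'a set" where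
  "eigenspace T \<nu> = {v. T v = \<nu> *s v}"

text \<open>The exponent may depend on the vector, since nilpotency is obtained below one
  generalized eigenvector at a time; in finite dimension this is ordinary nilpotency.\<close>

definition locally_nilpotent :: "('a \<Rightarrow> 'a) \<Rightarrow> bool" where
  "locally_nilpotent T \<longleftrightarrow> (\<forall>v. \<exists>n. (T ^^ n) v = 0)"

lemma shift_0 [simp]: "shift T 0 = T"
  by (rule ext) (simp add: shift_def)

lemma locally_nilpotent_iff: "locally_nilpotent T \<longleftrightarrow> gen_eigenspace T 0 = UNIV"
  by (auto simp: locally_nilpotent_def gen_eigenspace_def)

context
  fixes T assumes T: "linear_op T"
begin

lemma linear_shift: "linear_op (shift T \<nu>)"
  unfolding shift_def
  by (rule linear_opI) (simp_all add: linear_opD[OF T] algebra_simps scale_right_distrib)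

lemmas shift_simps = linear_opD[OF linear_shift]

lemmas shift_pow_simps = linear_opD[OF linear_op_funpow[OF linear_shift]]

lemma funpow_zero_mono:
  assumes "linear_op f" "(f ^^ n) v = 0" "n \<le> m"
  shows "(f ^^ m) v = 0"
proof -
  have "(f ^^ m) v = (f ^^ (m - n)) ((f ^^ n) v)"
    using assms(3) by (metis funpow_add le_add_diff_inverse2 o_apply)
  then show ?thesis using assms linear_opD(3)[OF linear_op_funpow] by simp
qed

lemma subspace_gen_eigenspace: "subspace (gen_eigenspace T \<nu>)"
proof (rule subspaceI)
  show "0 \<in> gen_eigenspace T \<nu>" by (auto simp: gen_eigenspace_def intro: exI[of _ 0])
next
  fix x y assume "x \<in> gen_eigenspace T \<nu>" "y \<in> gen_eigenspace T \<nu>"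
  then obtain n m where "(shift T \<nu> ^^ n) x = 0" "(shift T \<nu> ^^ m) y = 0"
    by (auto simp: gen_eigenspace_def)
  then have "(shift T \<nu> ^^ (max n m)) x = 0" "(shift T \<nu> ^^ (max n m)) y = 0"
    by (auto intro: funpow_zero_mono[OF linear_shift])
  then have "(shift T \<nu> ^^ (max n m)) (x + y) = 0" by (simp add: shift_pow_simps)
  then show "x + y \<in> gen_eigenspace T \<nu>" by (auto simp: gen_eigenspace_def)
next
  fix c x assume "x \<in> gen_eigenspace T \<nu>"
  then show "c *s x \<in> gen_eigenspace T \<nu>"
    by (force simp: gen_eigenspace_def shift_pow_simps)
qed

lemma subspace_eigenspace: "subspace (eigenspace T \<nu>)"
  unfolding eigenspace_def
  by (rule subspaceI) (simp_all add: linear_opD[OF T] scale_right_distrib mult.commute)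

lemma eigenspace_subset_gen: "eigenspace T \<nu> \<subseteq> gen_eigenspace T \<nu>"
  unfolding gen_eigenspace_def eigenspace_def
  by (auto simp: shift_def intro!: exI[of _ 1])

lemma gen_eigenspace_shift:
  assumes "v \<in> gen_eigenspace T \<nu>"
  shows "shift T \<mu> v \<in> gen_eigenspace T \<nu>"
proof -
  obtain n where n: "(shift T \<nu> ^^ n) v = 0" using assms by (auto simp: gen_eigenspace_def)
  have "(shift T \<nu> ^^ n) (shift T \<nu> v) = 0"
    using funpow_zero_mono[OF linear_shift n, of "Suc n"] by (simp add: funpow_swap1)
  then have "shift T \<nu> v \<in> gen_eigenspace T \<nu>" by (auto simp: gen_eigenspace_def)
  moreover have "shift T \<mu> v = shift T \<nu> v + (\<nu> - \<mu>) *s v"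
    by (simp add: shift_def algebra_simps scale_left_diff_distrib)
  ultimately show ?thesis
    using assms subspace_gen_eigenspace by (simp add: subspace_add subspace_scale)
qed

text \<open>A vector killed by T - \<mu> is one on which T - \<nu> acts as the nonzero scalar \<mu>
  - \<nu>, and no power of that scalar vanishes.\<close>

lemma shift_inj_on_gen_eigenspace:
  assumes "v \<in> gen_eigenspace T \<nu>" "\<mu> \<noteq> \<nu>" "shift T \<mu> v = 0"
  shows "v = 0"
proof -
  obtain n where n: "(shift T \<nu> ^^ n) v = 0" using assms by (auto simp: gen_eigenspace_def)
  have "(shift T \<nu> ^^ m) v = (\<mu> - \<nu>) ^ m *s v" for m
  proof (induction m)
    case (Suc m)
    have "shift T \<nu> v = (\<mu> - \<nu>) *s v"
      using assms(3) by (simp add: shift_def scale_left_diff_distrib)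
    then show ?case using Suc by (simp add: shift_simps mult.commute)
  qed simp
  with n have "(\<mu> - \<nu>) ^ n *s v = 0" by metis
  then show ?thesis using assms by simp
qed

lemma shift_pow_gen_eigenspace:
  "v \<in> gen_eigenspace T \<nu> \<Longrightarrow> (shift T \<mu> ^^ n) v \<in> gen_eigenspace T \<nu>"
  by (induction n) (auto intro: gen_eigenspace_shift)

lemma shift_pow_inj_on_gen_eigenspace:
  assumes "v \<in> gen_eigenspace T \<nu>" "\<mu> \<noteq> \<nu>" "(shift T \<mu> ^^ n) v = 0"
  shows "v = 0"
  using assms(3)
proof (induction n)
  case (Suc n)
  then show ?case
    using shift_inj_on_gen_eigenspace[OF shift_pow_gen_eigenspace[OF assms(1)] assms(2)] by simp
qed simp

text \<open>A power of T - \<nu> kills the component for \<nu>, while it preserves the other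
  generalized eigenspaces and is injective on them, so the induction hypothesis applies to the
  remaining sum.\<close>

lemma independent_family_gen_eigenspace: "independent_family UNIV (gen_eigenspace T)"
  unfolding independent_family_def
proof (intro allI impI)
  fix A u
  assume "finite A" "\<forall>i\<in>A. u i \<in> gen_eigenspace T i" "(\<Sum>i\<in>A. u i) = 0"
  then show "\<forall>i\<in>A. u i = 0"
  proof (induction A arbitrary: u rule: finite_induct)
    case (insert \<nu> A)
    then obtain n where n: "(shift T \<nu> ^^ n) (u \<nu>) = 0" by (auto simp: gen_eigenspace_def)
    let ?w = "\<lambda>i. (shift T \<nu> ^^ n) (u i)"
    have "(\<Sum>i\<in>insert \<nu> A. ?w i) = (shift T \<nu> ^^ n) (\<Sum>i\<in>insert \<nu> A. u i)"
      by (simp only: shift_pow_simps)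
    then have "(\<Sum>i\<in>A. ?w i) = 0" using insert n by (simp add: shift_pow_simps)
    then have "\<forall>i\<in>A. ?w i = 0"
      using insert.IH[of ?w] insert.prems by (auto intro: shift_pow_gen_eigenspace)
    then have "\<forall>i\<in>A. u i = 0"
      using insert.prems insert.hyps shift_pow_inj_on_gen_eigenspace by (metis insert_iff)
    then show ?case using insert by simp
  qed simp
qed

text \<open>On the generalized eigenspace, T - \<mu> is the nonzero scalar \<nu> - \<mu> plus the
  nilpotent T - \<nu>. The induction on the nilpotency exponent of v unrolls the geometric series
  for its inverse.\<close>

lemma shift_surj_on_gen_eigenspace:
  assumes "v \<in> gen_eigenspace T \<nu>" "\<mu> \<noteq> \<nu>"
  shows "\<exists>w \<in> gen_eigenspace T \<nu>. shift T \<mu> w = v"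
proof -
  have "\<exists>w \<in> gen_eigenspace T \<nu>. shift T \<mu> w = v"
    if "v \<in> gen_eigenspace T \<nu>" "(shift T \<nu> ^^ n) v = 0" for n v
    using that
  proof (induction n arbitrary: v)
    case 0
    then show ?case
      using subspace_0[OF subspace_gen_eigenspace] shift_simps(3) by auto
  next
    case (Suc n)
    let ?c = "inverse (\<nu> - \<mu>)"
    have c: "\<nu> - \<mu> \<noteq> 0" using assms by simp
    let ?u = "?c *s shift T \<nu> v"
    have "?u \<in> gen_eigenspace T \<nu>"
      using Suc subspace_gen_eigenspace gen_eigenspace_shift subspace_scale by blast
    moreover have "(shift T \<nu> ^^ n) ?u = 0"
      using Suc by (simp add: shift_pow_simps funpow_swap1)
    ultimately obtain w where w: "w \<in> gen_eigenspace T \<nu>" "shift T \<mu> w = ?u"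
      using Suc.IH by blast
    have "shift T \<mu> v = shift T \<nu> v + (\<nu> - \<mu>) *s v"
      by (simp add: shift_def algebra_simps scale_left_diff_distrib)
    then have "shift T \<mu> (?c *s v) = ?u + v"
      using c by (simp add: shift_simps scale_right_distrib)
    then have "shift T \<mu> (?c *s v - w) = v"
      using w by (simp add: shift_simps)
    moreover have "?c *s v - w \<in> gen_eigenspace T \<nu>"
      using Suc w subspace_gen_eigenspace by (simp add: subspace_diff subspace_scale)
    ultimately show ?case by blast
  qed
  then show ?thesis using assms by (auto simp: gen_eigenspace_def)
qed

text \<open>Components of (T - \<nu>) w at eigenvalues other than \<nu> can be lifted through T -
  \<nu>. After subtracting the lifts, T - \<nu> sends w into the generalized eigenspace of \<nu>, so
  the difference lies there too. This is what lets linear factors of a polynomial be stripped off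
  one by one.\<close>

lemma shift_in_span_gen_eigenspaces:
  assumes "shift T \<nu> w \<in> span (\<Union>\<mu>. gen_eigenspace T \<mu>)"
  shows "w \<in> span (\<Union>\<mu>. gen_eigenspace T \<mu>)"
proof -
  obtain A u where A: "finite A" "\<forall>i\<in>A. u i \<in> gen_eigenspace T i" "shift T \<nu> w = (\<Sum>i\<in>A. u i)"
    using in_span_UN_sum[OF assms] subspace_gen_eigenspace by blast
  have "\<forall>i\<in>A - {\<nu>}. \<exists>z \<in> gen_eigenspace T i. shift T \<nu> z = u i"
    using A(2) by (auto intro!: shift_surj_on_gen_eigenspace)
  then have "\<exists>z. \<forall>i\<in>A - {\<nu>}. z i \<in> gen_eigenspace T i \<and> shift T \<nu> (z i) = u i"
    by (intro bchoice) blast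
  then obtain z where z: "\<And>i. i \<in> A - {\<nu>} \<Longrightarrow> z i \<in> gen_eigenspace T i"
    "\<And>i. i \<in> A - {\<nu>} \<Longrightarrow> shift T \<nu> (z i) = u i"
    by blast
  let ?z = "\<Sum>i\<in>A - {\<nu>}. z i"
  have "shift T \<nu> (w - ?z) = (\<Sum>i\<in>A. u i) - (\<Sum>i\<in>A - {\<nu>}. u i)"
    using z A by (simp add: shift_simps)
  also have "\<dots> \<in> gen_eigenspace T \<nu>"
    using A subspace_0[OF subspace_gen_eigenspace]
    by (cases "\<nu> \<in> A") (auto simp: sum.remove)
  finally obtain n where "(shift T \<nu> ^^ n) (shift T \<nu> (w - ?z)) = 0"
    by (auto simp: gen_eigenspace_def)
  then have "w - ?z \<in> gen_eigenspace T \<nu>"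
    by (auto simp: gen_eigenspace_def funpow_swap1 intro!: exI[of _ "Suc n"])
  then have "w - ?z \<in> span (\<Union>\<mu>. gen_eigenspace T \<mu>)" by (intro span_base) blast
  moreover have "?z \<in> span (\<Union>\<mu>. gen_eigenspace T \<mu>)"
    using z by (intro span_sum span_base) blast
  ultimately show ?thesis
    using span_add[of "w - ?z" "\<Union>\<mu>. gen_eigenspace T \<mu>" ?z] by simp
qed

section \<open>Polynomials in an operator, applied to a vector by Horner's scheme\<close>

definition poly_op :: "'k poly \<Rightarrow> 'a \<Rightarrow> 'a" where
  "poly_op p v = fold_coeffs (\<lambda>a w. a *s v + T w) p 0"

lemma poly_op_0 [simp]: "poly_op 0 v = 0"
  by (simp add: poly_op_def)

lemma poly_op_pCons [simp]: "poly_op (pCons a p) v = a *s v + T (poly_op p v)"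
  by (cases "p = 0 \<and> a = 0") (auto simp: poly_op_def linear_opD[OF T])

lemma poly_op_add: "poly_op (p + q) v = poly_op p v + poly_op q v"
  by (induction p q rule: poly_induct2)
    (simp_all add: linear_opD[OF T] scale_left_distrib algebra_simps)

lemma poly_op_smult: "poly_op (smult c p) v = c *s poly_op p v"
  by (induction p) (simp_all add: linear_opD[OF T] scale_right_distrib)

lemma poly_op_monom: "poly_op (monom 1 n) v = (T ^^ n) v"
  by (induction n) (simp_all add: monom_0 monom_Suc linear_opD[OF T])

lemma poly_op_root_factor: "poly_op ([:- \<nu>, 1:] * q) v = shift T \<nu> (poly_op q v)"
proof -
  have "[:- \<nu>, 1:] * q = smult (- \<nu>) q + pCons 0 q" by simp
  then show ?thesis
    by (simp only: poly_op_add poly_op_smult poly_op_pCons) (simp add: shift_def)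
qed

end

end

locale fin_dim_space = linear_space scale
  for scale :: "'k::{alg_closed_field, field_char_0} \<Rightarrow> 'a::ab_group_add \<Rightarrow> 'a" (infixr \<open>*s\<close> 75) +
  assumes fin_dim: "\<exists>B. finite B \<and> span B = UNIV"
begin

text \<open>A fixed basis is chosen because \<open>finite_dimensional_vector_space\<close> takes one
  as a parameter; the trace is defined through it and shown afterwards not to depend on it.\<close>

definition some_basis :: "'a set" where
  "some_basis = (SOME B. independent B \<and> span B = UNIV)"

lemma some_basis: "independent some_basis" "span some_basis = UNIV"
proof -
  obtain B where "independent B" "span B = UNIV"
    by (metis maximal_independent_subset top.extremum_uniqueI)
  then have "\<exists>B. independent B \<and> span B = UNIV" by blast
  then have "independent some_basis \<and> span some_basis = UNIV"
    unfolding some_basis_def by (rule someI_ex)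
  then show "independent some_basis" "span some_basis = UNIV" by auto
qed

sublocale finite_dimensional_vector_space scale some_basis
proof
  obtain S where "finite S" "span S = UNIV" using fin_dim by blast
  then show "finite some_basis"
    using independent_span_bound[of S some_basis] some_basis by auto
qed (use some_basis in auto)

sublocale endo: vector_space_pair scale scale ..

text \<open>Among the vectors v, T v, T^2 v, ... some power depends on the earlier ones, which gives
  a nonzero polynomial p with p(T) v = 0. Over an algebraically closed field p splits, and removing
  its linear factors brings v itself into the span.\<close>

lemma span_gen_eigenspaces:
  assumes T: "linear_op T"
  shows "span (\<Union>\<mu>. gen_eigenspace T \<mu>) = UNIV"
proof -
  let ?W = "span (\<Union>\<mu>. gen_eigenspace T \<mu>)"
  have "v \<in> ?W" for v
  proof -
    let ?U = "\<lambda>n. (\<lambda>i. (T ^^ i) v) ` {..<n}"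
    have "\<exists>n. (T ^^ n) v \<in> span (?U n)"
    proof (rule ccontr)
      assume nin: "\<not> ?thesis"
      have "independent (?U n) \<and> card (?U n) = n" for n
      proof (induction n)
        case (Suc n)
        have U: "?U (Suc n) = insert ((T ^^ n) v) (?U n)" by (auto simp: lessThan_Suc)
        have nsp: "(T ^^ n) v \<notin> span (?U n)" using nin by blast
        then have "(T ^^ n) v \<notin> ?U n" by (rule contra_subsetD[OF span_superset])
        then have "card (?U (Suc n)) = Suc n" unfolding U using Suc by simp
        moreover have "independent (?U (Suc n))"
          unfolding U using nsp Suc by (intro independent_insertI) simp_all
        ultimately show ?case by (rule conjI[rotated])
      qed (simp add: independent_empty)
      then have "Suc (card some_basis) \<le> card some_basis"
        using independent_span_bound[OF finite_Basis, of "?U (Suc (card some_basis))"] span_Basis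
        by (metis subset_UNIV)
      then show False by simp
    qed
    then obtain n where n: "(T ^^ n) v \<in> span (?U n)" by blast
    have "\<exists>q. (\<forall>i\<ge>n. coeff q i = 0) \<and> x = poly_op T q v" if "x \<in> span (?U n)" for x
      using that
    proof (induction rule: span_induct_alt)
      case base
      show ?case by (rule exI[of _ 0]) (simp add: poly_op_0[OF T])
    next
      case (step c x y)
      then obtain q i where q: "\<forall>i\<ge>n. coeff q i = 0" "y = poly_op T q v" "i < n" "x = (T ^^ i) v"
        by auto
      then have "c *s x + y = poly_op T (smult c (monom 1 i) + q) v"
        by (simp add: poly_op_add[OF T] poly_op_smult[OF T] poly_op_monom[OF T])
      moreover have "\<forall>j\<ge>n. coeff (smult c (monom 1 i) + q) j = 0" using q by auto
      ultimately show ?case by blast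
    qed
    from this[OF n] obtain q where q: "\<forall>i\<ge>n. coeff q i = 0" "(T ^^ n) v = poly_op T q v" by blast
    let ?p = "monom 1 n + smult (- 1) q"
    have "coeff ?p n = 1" using q by simp
    then have "?p \<noteq> 0" by (metis coeff_0 zero_neq_one)
    moreover have "poly_op T ?p v \<in> ?W"
      using q by (simp only: poly_op_add[OF T] poly_op_smult[OF T] poly_op_monom[OF T])
        (simp add: span_zero)
    moreover have "v \<in> ?W" if "p \<noteq> 0" "poly_op T p v \<in> ?W" for p
      using that
    proof (induction "degree p" arbitrary: p)
      case 0
      then obtain a where "p = [:a:]" by (metis degree_eq_zeroE)
      with 0 have "a \<noteq> 0" "a *s v \<in> ?W" by (auto simp: poly_op_pCons[OF T] poly_op_0[OF T] linear_opD[OF T])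
      then show ?case using span_scale[of "a *s v" _ "inverse a"] by simp
    next
      case (Suc d)
      then obtain \<nu> where "poly p \<nu> = 0" using alg_closed_imp_poly_has_root[of p] by auto
      then obtain q where q: "p = [:- \<nu>, 1:] * q" by (auto simp: poly_eq_0_iff_dvd)
      have "q \<noteq> 0" using q Suc by auto
      have "degree p = Suc (degree q)"
        unfolding q using \<open>q \<noteq> 0\<close> by (subst degree_mult_eq) auto
      moreover have "poly_op T q v \<in> ?W"
        using Suc.prems(2) unfolding q poly_op_root_factor[OF T]
        by (rule shift_in_span_gen_eigenspaces[OF T])
      ultimately show ?case using Suc \<open>q \<noteq> 0\<close> by auto
    qed
    ultimately show ?thesis by blast
  qed
  then show ?thesis by blast
qed

end

section \<open>Traces\<close>

text \<open>Here \<open>'a\<close> is the scalar field. If f is nonzero on \<open>S\<close> and g is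
  the coordinate along s, then f + q g vanishes at one of the vectors for only finitely many q, and
  an infinite field offers another q.\<close>

lemma (in vector_space) ex_linear_functional_nonzero:
  assumes inf: "infinite (UNIV :: 'a set)" and S: "finite S" "0 \<notin> S"
  shows "\<exists>f. (\<forall>x y. f (x + y) = f x + f y) \<and> (\<forall>c x. f (scale c x) = c * f x) \<and> (\<forall>s\<in>S. f s \<noteq> 0)"
  using S
proof (induction S rule: finite_induct)
  case empty
  show ?case by (rule exI[of _ "\<lambda>_. 0"]) simp
next
  case (insert s S)
  then obtain f where f: "\<And>x y. f (x + y) = f x + f y" "\<And>c x. f (scale c x) = c * f x"
    "\<And>s. s \<in> S \<Longrightarrow> f s \<noteq> 0"
    by blast
  have "independent {s}" using insert by simp
  then obtain B where B: "{s} \<subseteq> B" "independent B" "span B = UNIV"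
    by (metis maximal_independent_subset_extend subset_UNIV top.extremum_uniqueI)
  let ?g = "\<lambda>x. representation B x s"
  have g: "?g (x + y) = ?g x + ?g y" "?g (scale c x) = c * ?g x" "?g s = 1" for x y c
    using B by (auto simp: representation_add representation_scale representation_basis)
  \<comment> \<open>If \<open>?g t\<close> is 0 the quotient is 0 by convention. This excludes one
    harmless value of q, since then f t + q g(t) = f t is nonzero anyway.\<close>
  have "finite (insert (- f s) ((\<lambda>t. - f t / ?g t) ` S))" using insert by simp
  then obtain q where q: "q \<notin> insert (- f s) ((\<lambda>t. - f t / ?g t) ` S)"
    using ex_new_if_finite[OF inf] by blast
  have "f t + q * ?g t \<noteq> 0" if "t \<in> insert s S" for t
  proof (cases "t = s")
    case True
    then show ?thesis using q g(3) by (auto simp: add_eq_0_iff minus_equation_iff)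
  next
    case False
    with that have t: "t \<in> S" by simp
    show ?thesis
    proof
      assume eq: "f t + q * ?g t = 0"
      with f(3)[OF t] have "?g t \<noteq> 0" by auto
      with eq have "q = - f t / ?g t" by (simp add: field_simps add_eq_0_iff)
      with q t show False by blast
    qed
  qed
  then show ?case
    by (intro exI[of _ "\<lambda>x. f x + q * ?g x"]) (auto simp: f g algebra_simps)
qed

text \<open>The field is regarded as a vector space over the rationals, which are infinite.\<close>

lemma ex_additive_rat_nonzero:
  fixes S :: "'k::field_char_0 set"
  assumes "finite S" "0 \<notin> S"
  shows "\<exists>f :: 'k \<Rightarrow> rat. (\<forall>x y. f (x + y) = f x + f y) \<and> (\<forall>c x. f (of_rat c * x) = c * f x) \<and>
    (\<forall>s\<in>S. f s \<noteq> 0)"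
proof -
  interpret vector_space "\<lambda>q (x::'k). of_rat q * x"
    by unfold_locales (simp_all add: algebra_simps of_rat_add of_rat_mult)
  show ?thesis
    using ex_linear_functional_nonzero[OF infinite_UNIV_char_0 assms] .
qed

context fin_dim_space
begin

text \<open>A basis of ker N^n is extended to one of ker N^(n+1), and N sends the new vectors into
  the span of the old ones. The condition \<open>N b \<in> span (B - {b})\<close> keeps from strict
  triangularity just what a trace sees: zero diagonal entries.\<close>

lemma ex_triangular_basis_kernel:
  assumes N: "linear_op N"
  shows "\<exists>B. independent B \<and> span B = {v. (N ^^ n) v = 0} \<and> (\<forall>b\<in>B. N b \<in> span (B - {b}))"
proof (induction n)
  case 0
  show ?case by (rule exI[of _ "{}"]) (auto simp: independent_empty)
next
  case (Suc n)
  let ?K = "\<lambda>n. {v. (N ^^ n) v = 0}"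
  note pow = linear_opD[OF linear_op_funpow[OF N]]
  have subK: "subspace (?K m)" for m
    by (rule subspaceI) (simp_all add: pow)
  from Suc obtain B where B: "independent B" "span B = ?K n" "\<And>b. b \<in> B \<Longrightarrow> N b \<in> span (B - {b})"
    by blast
  have "B \<subseteq> ?K n" using B(2) span_superset by blast
  then have "B \<subseteq> ?K (Suc n)"
    by (auto simp: linear_opD[OF N])
  then obtain B' where B': "B \<subseteq> B'" "B' \<subseteq> ?K (Suc n)" "independent B'" "?K (Suc n) \<subseteq> span B'"
    using maximal_independent_subset_extend[of B "?K (Suc n)"] B by blast
  have "N b \<in> span (B' - {b})" if "b \<in> B'" for b
  proof (cases "b \<in> B")
    case True
    have "span (B - {b}) \<subseteq> span (B' - {b})" using B' by (intro span_mono) blast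
    then show ?thesis using B(3)[OF True] by blast
  next
    case False
    have "N b \<in> span B" using B' that by (auto simp: B(2) funpow_swap1)
    moreover have "span B \<subseteq> span (B' - {b})" using B' False by (intro span_mono) blast
    ultimately show ?thesis by blast
  qed
  moreover have "span B' = ?K (Suc n)"
    using B' subK span_subspace by blast
  ultimately show ?case using B'(3) by blast
qed

lemma gen_eigenspace_eq_kernel:
  assumes T: "linear_op T"
  shows "\<exists>n. gen_eigenspace T \<nu> = {v. (shift T \<nu> ^^ n) v = 0}"
proof -
  note pow = linear_opD[OF linear_op_funpow[OF linear_shift[OF T]]]
  obtain B where B: "B \<subseteq> gen_eigenspace T \<nu>" "independent B" "gen_eigenspace T \<nu> \<subseteq> span B"
    using maximal_independent_subset by blast
  have fin: "finite B" using B(2) finiteI_independent by blast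
  have "\<forall>b\<in>B. \<exists>n. (shift T \<nu> ^^ n) b = 0" using B(1) by (auto simp: gen_eigenspace_def)
  then obtain k where k: "\<And>b. b \<in> B \<Longrightarrow> (shift T \<nu> ^^ k b) b = 0" by metis
  \<comment> \<open>For empty \<open>B\<close> this maximum is unspecified, which is harmless: the
    generalized eigenspace is then zero and any exponent works.\<close>
  let ?n = "Max (k ` B)"
  have "subspace {v. (shift T \<nu> ^^ ?n) v = 0}"
    by (rule subspaceI) (simp_all add: pow)
  moreover have "(shift T \<nu> ^^ ?n) b = 0" if "b \<in> B" for b
    using k[OF that] by (rule funpow_zero_mono[OF T linear_shift[OF T]]) (use fin that in simp)
  ultimately have "span B \<subseteq> {v. (shift T \<nu> ^^ ?n) v = 0}"
    by (intro span_minimal) auto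
  with B(3) have "gen_eigenspace T \<nu> = {v. (shift T \<nu> ^^ ?n) v = 0}"
    by (auto simp: gen_eigenspace_def)
  then show ?thesis by blast
qed

text \<open>A weak Jordan form: T minus the eigenvalue \<open>c b\<close> has a zero diagonal entry
  at b. It is glued from triangular bases of the generalized eigenspaces, whose independence makes
  \<open>c\<close> well defined.\<close>

lemma ex_jordan_basis:
  assumes T: "linear_op T"
  obtains B c where "independent B" "span B = UNIV" "finite B"
    "\<And>b. b \<in> B \<Longrightarrow> b \<in> gen_eigenspace T (c b)"
    "\<And>b. b \<in> B \<Longrightarrow> shift T (c b) b \<in> span (B - {b})"
    "\<And>\<nu>. gen_eigenspace T \<nu> \<subseteq> span {b \<in> B. c b = \<nu>}"
proof -
  have "\<exists>B. independent B \<and> span B = gen_eigenspace T \<nu> \<and> (\<forall>b\<in>B. shift T \<nu> b \<in> span (B - {b}))" for \<nu>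
    using ex_triangular_basis_kernel[OF linear_shift[OF T]] gen_eigenspace_eq_kernel[OF T] by metis
  then obtain E where E: "\<And>\<nu>. independent (E \<nu>)" "\<And>\<nu>. span (E \<nu>) = gen_eigenspace T \<nu>"
    "\<And>\<nu> b. b \<in> E \<nu> \<Longrightarrow> shift T \<nu> b \<in> span (E \<nu> - {b})"
    by metis
  have EG: "E \<nu> \<subseteq> gen_eigenspace T \<nu>" for \<nu> using E(2) span_superset by blast
  let ?B = "\<Union>\<nu>. E \<nu>"
  have indep: "independent ?B"
    using independent_UN[OF independent_family_gen_eigenspace[OF T] subspace_gen_eigenspace[OF T]] E(1) EG
    by blast
  have "gen_eigenspace T \<nu> \<subseteq> span ?B" for \<nu>
    unfolding E(2)[symmetric] by (intro span_mono) blast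
  then have "span (\<Union>\<nu>. gen_eigenspace T \<nu>) \<subseteq> span ?B"
    by (intro span_minimal) auto
  then have spn: "span ?B = UNIV" using span_gen_eigenspaces[OF T] by auto
  define c where "c b = (SOME \<nu>. b \<in> E \<nu>)" for b
  have bc: "b \<in> E (c b)" if "b \<in> ?B" for b
    unfolding c_def using that by (auto intro: someI)
  have c: "c b = \<nu>" if "b \<in> E \<nu>" for b \<nu>
  proof (rule ccontr)
    assume ne: "c b \<noteq> \<nu>"
    have "b \<in> E (c b)" using bc that by blast
    then have "b \<in> gen_eigenspace T (c b)" using EG by blast
    moreover have "b \<in> span (\<Union>i\<in>{\<nu>}. gen_eigenspace T i)" using that EG by (auto intro: span_base)
    ultimately have "b = 0"
      using independent_family_Int_span[OF independent_family_gen_eigenspace[OF T]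
          subspace_gen_eigenspace[OF T], of "{\<nu>}" "c b"] ne by auto
    then show False using that E(1) dependent_zero by blast
  qed
  have eq: "E \<nu> = {b \<in> ?B. c b = \<nu>}" for \<nu>
    using c bc by blast
  show ?thesis
  proof (rule that[of ?B c])
    show "finite ?B" using indep by (rule finiteI_independent)
    show "b \<in> gen_eigenspace T (c b)" if "b \<in> ?B" for b using bc[OF that] EG by blast
    show "shift T (c b) b \<in> span (?B - {b})" if "b \<in> ?B" for b
    proof -
      have "span (E (c b) - {b}) \<subseteq> span (?B - {b})" by (intro span_mono) blast
      then show ?thesis using E(3)[OF bc[OF that]] by blast
    qed
    show "gen_eigenspace T \<nu> \<subseteq> span {b \<in> ?B. c b = \<nu>}" for \<nu>
      unfolding eq[symmetric] E(2) by simp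
  qed (use indep spn in auto)
qed

text \<open>With \<phi> the identity this is the semisimple part of T; with rational-valued \<phi>
  it is the operator of Cartan's criterion.\<close>

lemma ex_diagonal_op:
  assumes T: "linear_op T"
  shows "\<exists>D. linear_op D \<and> (\<forall>\<nu>. \<forall>v \<in> gen_eigenspace T \<nu>. D v = \<phi> \<nu> *s v)"
proof -
  obtain B c where B: "independent B" "span B = UNIV"
    "\<And>\<nu>. gen_eigenspace T \<nu> \<subseteq> span {b \<in> B. c b = \<nu>}"
    using ex_jordan_basis[OF T] by metis
  let ?D = "endo.construct B (\<lambda>b. \<phi> (c b) *s b)"
  have lin: "linear_op ?D" using B(1) by (rule endo.linear_construct)
  have "?D v = \<phi> \<nu> *s v" if "v \<in> span {b \<in> B. c b = \<nu>}" for v \<nu>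
    using that
  proof (induction rule: span_induct_alt)
    case (step a x y)
    then have "?D x = \<phi> \<nu> *s x" using endo.construct_basis[OF B(1)] by auto
    then show ?case using step by (simp add: linear_opD[OF lin] scale_right_distrib mult.commute)
  qed (simp add: linear_opD[OF lin])
  then show ?thesis using lin B(3) by blast
qed

section \<open>The trace, and its value on products with diagonal operators\<close>

definition op_trace :: "('a \<Rightarrow> 'a) \<Rightarrow> 'k" where
  "op_trace f = (\<Sum>b\<in>some_basis. representation some_basis (f b) b)"

lemma representation_image:
  assumes "linear_op f" "independent B" "span B = UNIV" "independent C" "span C = UNIV"
  shows "representation B (f x) b = (\<Sum>c\<in>C. representation C x c * representation B (f c) b)"
proof -
  have C: "finite C" using assms(4) finiteI_independent by blast
  have "f x = f (\<Sum>c\<in>C. representation C x c *s c)"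
    using sum_representation_eq[OF assms(4), of x C] assms(5) C by simp
  also have "\<dots> = (\<Sum>c\<in>C. representation C x c *s f c)"
    by (simp add: linear_opD[OF assms(1)])
  finally show ?thesis
    using assms by (simp add: representation_sum representation_scale)
qed

text \<open>Two bases are allowed so that one computation yields both classical facts: equal bases
  give tr(fg) = tr(gf), and g = id gives independence of the basis.\<close>

lemma trace_swap:
  assumes "linear_op f" "linear_op g" "independent B" "span B = UNIV" "independent C" "span C = UNIV"
  shows "(\<Sum>b\<in>B. representation B (f (g b)) b) = (\<Sum>c\<in>C. representation C (g (f c)) c)"
proof -
  have "(\<Sum>b\<in>B. representation B (f (g b)) b)
      = (\<Sum>b\<in>B. \<Sum>c\<in>C. representation C (g b) c * representation B (f c) b)"
    by (intro sum.cong refl representation_image assms)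
  also have "\<dots> = (\<Sum>c\<in>C. \<Sum>b\<in>B. representation B (f c) b * representation C (g b) c)"
    by (subst sum.swap) (simp add: mult.commute)
  also have "\<dots> = (\<Sum>c\<in>C. representation C (g (f c)) c)"
    by (intro sum.cong refl representation_image[symmetric] assms)
  finally show ?thesis .
qed

lemma op_trace_basis:
  assumes "linear_op f" "independent B" "span B = UNIV"
  shows "op_trace f = (\<Sum>b\<in>B. representation B (f b) b)"
  using trace_swap[OF assms(1) linear_opI, of "\<lambda>x. x" some_basis B] assms some_basis
  by (simp add: op_trace_def)

lemma op_trace_commute: "linear_op f \<Longrightarrow> linear_op g \<Longrightarrow> op_trace (\<lambda>x. f (g x)) = op_trace (\<lambda>x. g (f x))"
  unfolding op_trace_def by (rule trace_swap) (auto simp: some_basis)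

lemma op_trace_add: "op_trace (\<lambda>x. f x + g x) = op_trace f + op_trace g"
  by (simp add: op_trace_def representation_add some_basis sum.distrib)

lemma op_trace_scale: "op_trace (\<lambda>x. c *s f x) = c * op_trace f"
  by (simp add: op_trace_def representation_scale some_basis sum_distrib_left)

lemma op_trace_diff: "op_trace (\<lambda>x. f x - g x) = op_trace f - op_trace g"
  by (simp add: op_trace_def representation_diff some_basis sum_subtractf)

text \<open>The basis and the eigenvalues are produced before D and \<phi> are quantified, because
  Cartan's criterion chooses \<phi> in terms of the eigenvalues \<open>c b\<close>. Only the
  diagonal of T D counts, and there T - c b contributes nothing.\<close>

lemma ex_trace_formula:
  assumes T: "linear_op T"
  obtains B c where "independent B" "span B = UNIV" "finite B"
    "\<And>b. b \<in> B \<Longrightarrow> b \<in> gen_eigenspace T (c b)"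
    "\<forall>D \<phi>. linear_op D \<longrightarrow> (\<forall>\<nu>. \<forall>v \<in> gen_eigenspace T \<nu>. D v = \<phi> \<nu> *s v)
      \<longrightarrow> op_trace (\<lambda>x. T (D x)) = (\<Sum>b\<in>B. c b * \<phi> (c b))"
proof -
  obtain B c where B: "independent B" "span B = UNIV" "finite B"
    "\<And>b. b \<in> B \<Longrightarrow> b \<in> gen_eigenspace T (c b)"
    "\<And>b. b \<in> B \<Longrightarrow> shift T (c b) b \<in> span (B - {b})"
    "\<And>\<nu>. gen_eigenspace T \<nu> \<subseteq> span {b \<in> B. c b = \<nu>}"
    by (rule ex_jordan_basis[OF T]) (rule that; assumption)
  have "op_trace (\<lambda>x. T (D x)) = (\<Sum>b\<in>B. c b * \<phi> (c b))"
    if D: "linear_op D" "\<forall>\<nu>. \<forall>v \<in> gen_eigenspace T \<nu>. D v = \<phi> \<nu> *s v" for D \<phi>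
  proof -
    have "representation B (T (D b)) b = c b * \<phi> (c b)" if "b \<in> B" for b
    proof -
      have "T (D b) = \<phi> (c b) *s shift T (c b) b + (c b * \<phi> (c b)) *s b"
        using bspec[OF spec[OF D(2)] B(4)[OF that]]
        by (simp add: linear_opD[OF T] shift_def scale_right_diff_distrib mult.commute)
      moreover have "representation B (shift T (c b) b) b = 0"
      proof -
        have "representation B (shift T (c b) b) = representation (B - {b}) (shift T (c b) b)"
          using B(1) B(5)[OF that] by (intro representation_extend) auto
        then show ?thesis by (metis DiffD2 representation_ne_zero singletonI)
      qed
      ultimately show ?thesis
        using B that by (simp add: representation_add representation_scale representation_basis)
    qed
    then show ?thesis
      using op_trace_basis[OF linear_op_compose[OF T D(1)] B(1,2)] by simp
  qed
  with B(1-4) show ?thesis by (intro that) blast+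
qed

lemma op_trace_locally_nilpotent:
  assumes T: "linear_op T" and "locally_nilpotent T"
  shows "op_trace T = 0"
proof -
  obtain B c where B: "independent B" "span B = UNIV" "finite B"
    "\<And>b. b \<in> B \<Longrightarrow> b \<in> gen_eigenspace T (c b)"
    "\<forall>D \<phi>. linear_op D \<longrightarrow> (\<forall>\<nu>. \<forall>v \<in> gen_eigenspace T \<nu>. D v = \<phi> \<nu> *s v)
      \<longrightarrow> op_trace (\<lambda>x. T (D x)) = (\<Sum>b\<in>B. c b * \<phi> (c b))"
    by (rule ex_trace_formula[OF T]) (rule that; assumption)
  have "c b = 0" if "b \<in> B" for b
  proof (rule ccontr)
    assume "c b \<noteq> 0"
    obtain n where "(shift T 0 ^^ n) b = 0" using assms(2) by (auto simp: locally_nilpotent_def)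
    with \<open>c b \<noteq> 0\<close> have "b = 0"
      using shift_pow_inj_on_gen_eigenspace[OF T B(4)[OF that], of 0] by simp
    then show False using that B(1) dependent_zero by blast
  qed
  moreover have "op_trace (\<lambda>x. T (id x)) = (\<Sum>b\<in>B. c b * 1)"
    by (rule B(5)[rule_format]) (auto intro: linear_opI)
  ultimately show ?thesis by simp
qed

end

section \<open>Engel's theorem and the Killing form\<close>

locale semisimple_lie_algebra_char0 = semisimple_lie_algebra scale bracket
  for scale :: "'k::{alg_closed_field, field_char_0} \<Rightarrow> 'a::ab_group_add \<Rightarrow> 'a" (infixr \<open>*s\<close> 75)
    and bracket :: "'a \<Rightarrow> 'a \<Rightarrow> 'a"
begin

sublocale fin_dim_space scale
  by unfold_locales (rule finite_dimensional)

lemma linear_bracket: "linear_op (bracket x)"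
  by (rule linear_opI) (rule bracket_add_right bracket_scale_right)+

lemma linear_bracket_left: "linear_op (\<lambda>x. bracket x y)"
  by (rule linear_opI) (rule bracket_add_left bracket_scale_left)+

lemmas bracket_simps =
  linear_opD[OF linear_bracket] linear_opD[OF linear_bracket_left]

lemma bracket_skew: "bracket x y = - bracket y x"
proof -
  have "bracket x (x + y) + bracket y (x + y) = 0"
    by (metis bracket_add_left bracket_self)
  then have "bracket x y + bracket y x = 0"
    by (simp add: bracket_add_right bracket_self)
  then show ?thesis by (simp add: eq_neg_iff_add_eq_0)
qed

lemma bracket_eq_0_commute: "bracket x y = 0 \<longleftrightarrow> bracket y x = 0"
  by (subst bracket_skew) simp

lemma bracket_leibniz: "bracket x (bracket y z) = bracket (bracket x y) z + bracket y (bracket x z)"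
  using jacobi[of x y z] bracket_skew[of z "bracket x y"] bracket_skew[of z x]
  by (simp add: bracket_simps algebra_simps)

lemma bracket_bracket: "bracket (bracket x y) z = bracket x (bracket y z) - bracket y (bracket x z)"
  using bracket_leibniz[of x y z] by simp

lemma abelian_ideal_eq_0:
  assumes "lie_ideal Z" "\<And>x y. x \<in> Z \<Longrightarrow> y \<in> Z \<Longrightarrow> bracket x y = 0"
  shows "Z = {0}"
proof -
  have "commutator Z Z \<subseteq> {0}"
    unfolding commutator_def using assms(2) by (intro span_minimal) auto
  moreover have "0 \<in> commutator Z Z"
    unfolding commutator_def by (rule span_zero)
  ultimately have "derived_series Z 1 = {0}" by auto
  then have "solvable Z" unfolding solvable_def by blast
  then show ?thesis using assms semisimple by blast
qed

lemma central_eq_0: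
  assumes "\<And>y. bracket y x = 0"
  shows "x = 0"
proof -
  have "lie_ideal {x. \<forall>y. bracket y x = 0}"
    unfolding lie_ideal_def by (auto intro!: subspaceI simp: bracket_simps)
  then have "{x. \<forall>y. bracket y x = 0} = {0}" by (rule abelian_ideal_eq_0) simp
  then show ?thesis using assms by blast
qed

lemma dim_strict_mono: "subspace U \<Longrightarrow> subspace V \<Longrightarrow> U \<subset> V \<Longrightarrow> dim U < dim V"
  by (metis dim_psubset span_eq_iff)

text \<open>Engel's theorem for a pair U < W of K-stable subspaces, a form that fits both uses of
  the induction hypothesis. Let M be a proper subalgebra of K of largest dimension. Applied to M <
  K, the hypothesis yields w outside M that normalizes M, whence K = M + span w; applied to U < W,
  it yields v that M maps into U. What remains is to control w.\<close>

lemma engel: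
  assumes nil: "\<And>x. x \<in> K \<Longrightarrow> locally_nilpotent (bracket x)"
    and "subalgebra K" "subspace U" "subspace W" "U \<subset> W"
    and "\<And>x w. x \<in> K \<Longrightarrow> w \<in> W \<Longrightarrow> bracket x w \<in> W"
    and "\<And>x u. x \<in> K \<Longrightarrow> u \<in> U \<Longrightarrow> bracket x u \<in> U"
  shows "\<exists>w\<in>W - U. \<forall>x\<in>K. bracket x w \<in> U"
  using assms
proof (induction "dim K" arbitrary: K U W rule: less_induct)
  case less
  note nil = less.prems(1) and K = less.prems(2) and U = less.prems(3) and W = less.prems(4)
    and UW = less.prems(5) and KW = less.prems(6) and KU = less.prems(7)
  have sK: "subspace K" and bK: "\<And>x y. x \<in> K \<Longrightarrow> y \<in> K \<Longrightarrow> bracket x y \<in> K"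
    using K by (auto simp: subalgebra_def)
  show ?case
  proof (cases "K = {0}")
    case True
    then show ?thesis using UW subspace_0[OF U] by (auto simp: bracket_simps)
  next
    case False
    let ?P = "\<lambda>M. subalgebra M \<and> M \<subset> K"
    have "?P {0}" using False subspace_0[OF sK] by (auto simp: subalgebra_def bracket_simps)
    then have "\<exists>M. ?P M \<and> (\<forall>M'. ?P M' \<longrightarrow> dim M' \<le> dim M)"
      by (rule ex_has_greatest_nat[where b = "Suc dimension"]) (simp add: dim_subset_UNIV less_Suc_eq_le)
    then obtain M where M: "subalgebra M" "M \<subset> K" "\<And>M'. subalgebra M' \<Longrightarrow> M' \<subset> K \<Longrightarrow> dim M' \<le> dim M"
      by metis
    have sM: "subspace M" and bM: "\<And>x y. x \<in> M \<Longrightarrow> y \<in> M \<Longrightarrow> bracket x y \<in> M" and MK: "M \<subset> K"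
      using M by (auto simp: subalgebra_def)
    have dM: "dim M < dim K" using sM sK MK by (rule dim_strict_mono)
    have "\<exists>w\<in>K - M. \<forall>x\<in>M. bracket x w \<in> M"
      using M MK sM sK by (intro less.hyps[OF dM] nil bK bM) auto
    then obtain w where w: "w \<in> K" "w \<notin> M" "\<And>x. x \<in> M \<Longrightarrow> bracket x w \<in> M" by blast
    let ?M' = "{m + c *s w | m c. m \<in> M}"
    have sM': "subspace ?M'"
    proof (rule subspaceI)
      show "0 \<in> ?M'" using subspace_0[OF sM] by (intro CollectI exI[of _ 0]) simp
    next
      fix x y assume "x \<in> ?M'" "y \<in> ?M'"
      then obtain m c m' c' where m: "x = m + c *s w" "y = m' + c' *s w" "m \<in> M" "m' \<in> M" by blast
      have "x + y = (m + m') + (c + c') *s w" using m by (simp add: scale_left_distrib algebra_simps)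
      then show "x + y \<in> ?M'" using m subspace_add[OF sM] by blast
    next
      fix a x assume "x \<in> ?M'"
      then obtain m c where m: "x = m + c *s w" "m \<in> M" by blast
      have "a *s x = a *s m + (a * c) *s w" using m by (simp add: scale_right_distrib)
      then show "a *s x \<in> ?M'" using m subspace_scale[OF sM] by blast
    qed
    have "bracket x y \<in> ?M'" if "x \<in> ?M'" "y \<in> ?M'" for x y
    proof -
      obtain m c m' c' where m: "x = m + c *s w" "y = m' + c' *s w" "m \<in> M" "m' \<in> M"
        using \<open>x \<in> ?M'\<close> \<open>y \<in> ?M'\<close> by blast
      have "bracket x y = (bracket m m' + c' *s bracket m w - c *s bracket m' w) + 0 *s w"
        using bracket_skew[of w m'] by (simp add: m bracket_simps bracket_self algebra_simps)
      moreover have "bracket m m' + c' *s bracket m w - c *s bracket m' w \<in> M"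
        using m bM w(3) sM by (simp add: subspace_add subspace_diff subspace_scale)
      ultimately show ?thesis by blast
    qed
    then have aM': "subalgebra ?M'" using sM' unfolding subalgebra_def by blast
    have "x \<in> ?M'" if "x \<in> M" for x
      using that by (intro CollectI exI[of _ x] exI[of _ 0]) simp
    moreover have "w \<in> ?M'"
      using subspace_0[OF sM] by (intro CollectI exI[of _ 0] exI[of _ 1]) simp
    ultimately have "M \<subset> ?M'" using w(2) by blast
    then have "dim M < dim ?M'" using sM sM' by (intro dim_strict_mono)
    moreover have "?M' \<subseteq> K"
      using MK w(1) sK by (auto intro!: subspace_add subspace_scale)
    ultimately have KM': "K = ?M'" using M(3)[OF aM'] by force
    have "\<exists>v\<in>W - U. \<forall>x\<in>M. bracket x v \<in> U"
      using M MK U W UW by (intro less.hyps[OF dM] nil KW KU) auto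
    then obtain v where v: "v \<in> W" "v \<notin> U" "\<And>x. x \<in> M \<Longrightarrow> bracket x v \<in> U" by blast
    \<comment> \<open>ad w is applied to v until just before the result falls into U. Every iterate
      is still sent into U by M, because ad x passes over ad w at the cost of ad [x, w], and [x, w]
      lies in M.\<close>
    let ?v = "\<lambda>n. (bracket w ^^ n) v"
    have vn: "?v n \<in> W \<and> (\<forall>x\<in>M. bracket x (?v n) \<in> U)" for n
    proof (induction n)
      case (Suc n)
      have "bracket x (bracket w (?v n)) \<in> U" if "x \<in> M" for x
        unfolding bracket_leibniz[of x w]
        using Suc KU w that by (intro subspace_add[OF U]) auto
      then show ?case using Suc KW w by simp
    qed (use v in auto)
    have "\<exists>n. ?v n \<in> U"
      using nil[OF w(1)] subspace_0[OF U] unfolding locally_nilpotent_def by metis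
    then have n: "?v (LEAST n. ?v n \<in> U) \<in> U" by (rule LeastI_ex)
    then have "(LEAST n. ?v n \<in> U) \<noteq> 0" using v by (metis funpow_0)
    then obtain k where k: "(LEAST n. ?v n \<in> U) = Suc k" by (metis not0_implies_Suc)
    have kU: "?v k \<notin> U" using not_less_Least[of k "\<lambda>n. ?v n \<in> U"] k by simp
    have wU: "bracket w (?v k) \<in> U" using n k by simp
    have "bracket x (?v k) \<in> U" if "x \<in> K" for x
    proof -
      obtain m c where "x = m + c *s w" "m \<in> M" using \<open>x \<in> K\<close> unfolding KM' by blast
      then show ?thesis using vn[of k] wU U by (simp add: bracket_simps subspace_add subspace_scale)
    qed
    then show ?thesis using kU vn by blast
  qed
qed

text \<open>Engel's theorem for 0 < J gives a nonzero element of J centralized by J. By the Jacobi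
  identity the centre of J is an ideal of the whole algebra, so it would be a nonzero abelian
  ideal.\<close>

lemma ad_nilpotent_ideal_eq_0:
  assumes J: "lie_ideal J" and nil: "\<And>x. x \<in> J \<Longrightarrow> locally_nilpotent (bracket x)"
  shows "J = {0}"
proof (rule ccontr)
  assume "J \<noteq> {0}"
  have sJ: "subspace J" and bJ: "\<And>x y. y \<in> J \<Longrightarrow> bracket x y \<in> J"
    using J by (auto simp: lie_ideal_def)
  have "\<exists>w\<in>J - {0}. \<forall>x\<in>J. bracket x w \<in> {0}"
    using \<open>J \<noteq> {0}\<close> sJ subspace_0[OF sJ]
    by (intro engel nil) (auto simp: subalgebra_def bJ bracket_simps)
  then obtain w where w: "w \<in> J" "w \<noteq> 0" "\<And>x. x \<in> J \<Longrightarrow> bracket x w = 0" by blast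
  let ?Z = "{z \<in> J. \<forall>x\<in>J. bracket x z = 0}"
  have "bracket y z \<in> ?Z" if "z \<in> ?Z" for y z
  proof -
    have "bracket x (bracket y z) = 0" if "x \<in> J" for x
    proof -
      have "bracket x y \<in> J" using bJ[OF that, of y] bracket_skew[of x y] subspace_neg[OF sJ] by simp
      then show ?thesis
        using that \<open>z \<in> ?Z\<close> by (simp add: bracket_leibniz[of x y] bracket_simps)
    qed
    then show ?thesis using that bJ by blast
  qed
  moreover have "subspace ?Z"
    using sJ by (auto intro!: subspaceI simp: bracket_simps subspace_0 subspace_add subspace_scale)
  ultimately have "lie_ideal ?Z" by (simp add: lie_ideal_def)
  then have "?Z = {0}" by (rule abelian_ideal_eq_0) blast
  then show False using w by blast
qed

section \<open>The Killing form and its nondegeneracy\<close>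

definition killing :: "'a \<Rightarrow> 'a \<Rightarrow> 'k" where
  "killing x y = op_trace (\<lambda>z. bracket x (bracket y z))"

lemma linear_bracket_bracket: "linear_op (\<lambda>z. bracket x (bracket y z))"
  by (rule linear_op_compose[OF linear_bracket linear_bracket])

lemma killing_commute: "killing x y = killing y x"
  unfolding killing_def by (intro op_trace_commute linear_bracket)

lemma killing_add_left: "killing (x + y) z = killing x z + killing y z"
  by (simp add: killing_def bracket_add_left op_trace_add)

lemma killing_scale_left: "killing (c *s x) y = c * killing x y"
  by (simp add: killing_def bracket_scale_left op_trace_scale)

lemma killing_add_right: "killing z (x + y) = killing z x + killing z y"
  using killing_add_left by (simp add: killing_commute[of z])

lemma killing_scale_right: "killing y (c *s x) = c * killing y x"
  using killing_scale_left by (simp add: killing_commute[of y])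

lemma killing_zero_left: "killing 0 x = 0"
  using killing_scale_left[of 0 0 x] by simp

lemma killing_zero_right: "killing x 0 = 0"
  using killing_scale_right[of x 0 0] by simp

lemma killing_minus_left: "killing (- x) y = - killing x y"
  using killing_scale_left[of "- 1" x y] by simp

lemma killing_minus_right: "killing y (- x) = - killing y x"
  using killing_scale_right[of y "- 1" x] by simp

lemma killing_diff_left: "killing (x - y) z = killing x z - killing y z"
  using killing_add_left[of x "- y" z] by (simp add: killing_minus_left)

lemma killing_diff_right: "killing z (x - y) = killing z x - killing z y"
  using killing_add_right[of z x "- y"] by (simp add: killing_minus_right)

lemmas killing_simps = killing_add_left killing_add_right killing_scale_left killing_scale_right
  killing_zero_left killing_zero_right killing_minus_left killing_minus_right
  killing_diff_left killing_diff_right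

text \<open>Both sides contain tr(ad x ad y ad z); the two remaining terms agree by cyclicity of the
  trace.\<close>

lemma killing_invariant: "killing (bracket x y) z = killing x (bracket y z)"
proof -
  have "op_trace (\<lambda>v. bracket y (bracket x (bracket z v))) = op_trace (\<lambda>v. bracket x (bracket z (bracket y v)))"
    by (rule op_trace_commute[OF linear_bracket linear_bracket_bracket])
  then show ?thesis
    by (simp add: killing_def bracket_bracket[of x y] bracket_bracket[of y z] op_trace_diff bracket_simps)
qed

text \<open>ad x - (\<mu> + \<nu>) obeys a Leibniz rule with ad x - \<mu> on the left factor and ad
  x - \<nu> on the right one. Each application uses up one of the n + m available powers.\<close>

lemma bracket_gen_eigenspace:
  assumes "u \<in> gen_eigenspace (bracket x) \<mu>" "v \<in> gen_eigenspace (bracket x) \<nu>"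
  shows "bracket u v \<in> gen_eigenspace (bracket x) (\<mu> + \<nu>)"
proof -
  let ?s = "shift (bracket x)"
  note pow = linear_opD[OF linear_op_funpow[OF linear_shift[OF linear_bracket]]]
  have leibniz: "?s (\<mu> + \<nu>) (bracket u v) = bracket (?s \<mu> u) v + bracket u (?s \<nu> v)" for u v
    by (simp add: shift_def bracket_leibniz[of x] bracket_simps scale_left_distrib algebra_simps)
  have "(?s (\<mu> + \<nu>) ^^ k) (bracket u v) = 0"
    if "(?s \<mu> ^^ n) u = 0" "(?s \<nu> ^^ m) v = 0" "k = n + m" for n m k u v
    using that
  proof (induction k arbitrary: n m u v)
    case 0
    then show ?case by (simp add: bracket_simps)
  next
    case (Suc k)
    show ?case
    proof (cases "n = 0 \<or> m = 0")
      case True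
      then have "bracket u v = 0" using Suc by (auto simp: bracket_simps)
      then show ?thesis by (simp only: pow)
    next
      case False
      then obtain n' m' where nm: "n = Suc n'" "m = Suc m'" by (metis not0_implies_Suc)
      have "(?s (\<mu> + \<nu>) ^^ k) (bracket (?s \<mu> u) v) = 0"
        by (rule Suc.IH[of n' _ m]) (use Suc nm in \<open>auto simp: funpow_swap1\<close>)
      moreover have "(?s (\<mu> + \<nu>) ^^ k) (bracket u (?s \<nu> v)) = 0"
        by (rule Suc.IH[of n _ m']) (use Suc nm in \<open>auto simp: funpow_swap1\<close>)
      ultimately show ?thesis by (simp only: funpow_Suc_right o_apply leibniz pow) simp
    qed
  qed
  then show ?thesis using assms unfolding gen_eigenspace_def by blast
qed

text \<open>Brackets add generalized eigenvalues, so additivity of \<phi> is the product rule on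
  generalized eigenvectors; these span, and both sides are bilinear.\<close>

lemma diagonal_op_derivation:
  assumes D: "linear_op D" "\<And>\<nu> v. v \<in> gen_eigenspace (bracket x) \<nu> \<Longrightarrow> D v = \<phi> \<nu> *s v"
    and \<phi>: "\<And>a b. \<phi> (a + b) = \<phi> a + \<phi> b"
  shows "D (bracket u v) = bracket (D u) v + bracket u (D v)"
proof -
  let ?G = "\<Union>\<nu>. gen_eigenspace (bracket x) \<nu>"
  have "u \<in> span ?G" "v \<in> span ?G" using span_gen_eigenspaces[OF linear_bracket] by auto
  then show ?thesis
  proof (induction u rule: span_induct_alt)
    case (step c u w)
    have "D (bracket u v) = bracket (D u) v + bracket u (D v)"
      using step.prems
    proof (induction v rule: span_induct_alt)
      case (step c' v z)
      from \<open>u \<in> ?G\<close> \<open>v \<in> ?G\<close> obtain \<mu> \<nu> where uv: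
        "u \<in> gen_eigenspace (bracket x) \<mu>" "v \<in> gen_eigenspace (bracket x) \<nu>" by blast
      have "D (bracket u v) = bracket (D u) v + bracket u (D v)"
        using D(2)[OF bracket_gen_eigenspace[OF uv]] D(2)[OF uv(1)] D(2)[OF uv(2)]
        by (simp add: \<phi> bracket_simps scale_left_distrib)
      then show ?case using step
        by (simp add: linear_opD[OF D(1)] bracket_simps scale_right_distrib algebra_simps)
    qed (simp add: linear_opD[OF D(1)] bracket_simps)
    then show ?case using step
      by (simp add: linear_opD[OF D(1)] bracket_simps scale_right_distrib algebra_simps)
  qed (simp add: linear_opD[OF D(1)] bracket_simps)
qed

text \<open>
  Cartan's criterion. Let \<open>S\<close> be the radical of the form and \<open>z \<in> [S, L]\<close>. For an additive
  \<open>\<phi>\<close> with rational values, scaling the generalized eigenspaces of \<open>ad z\<close> by \<open>\<phi>\<close> is a derivation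
  \<open>D\<close>, and invariance gives \<open>tr (ad z \<circ> D) = 0\<close>. Applying \<open>\<phi>\<close> to this trace gives a vanishing sum
  of rational squares, so \<open>ad z\<close> is nilpotent.
\<close>

lemma killing_nondegenerate:
  assumes "\<And>y. killing x y = 0"
  shows "x = 0"
proof -
  let ?S = "{x. \<forall>y. killing x y = 0}"
  let ?J = "span {bracket x y | x y. x \<in> ?S}"
  have sS: "subspace ?S" by (auto intro!: subspaceI simp: killing_simps)
  have bS: "bracket x y \<in> ?S" if "x \<in> ?S" for x y
    using that by (simp add: killing_invariant)
  have bS': "bracket y x \<in> ?S" if "x \<in> ?S" for x y
    using bS[OF that, of y] subspace_neg[OF sS] bracket_skew[of y x] by metis
  have JS: "?J \<subseteq> ?S" using bS by (intro span_minimal[OF _ sS]) blast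
  have "lie_ideal ?J"
    unfolding lie_ideal_def
  proof (intro conjI allI ballI)
    fix y z assume "z \<in> ?J"
    then have "z \<in> ?S" using JS by blast
    then have "bracket z y \<in> ?J" by (intro span_base) blast
    then show "bracket y z \<in> ?J" unfolding bracket_skew[of y z] by (rule span_neg)
  qed simp
  moreover have "locally_nilpotent (bracket z)" if "z \<in> ?J" for z
  proof -
    obtain B c where B: "independent B" "span B = UNIV" "finite B"
      "\<And>b. b \<in> B \<Longrightarrow> b \<in> gen_eigenspace (bracket z) (c b)"
      "\<forall>D \<phi>. linear_op D \<longrightarrow> (\<forall>\<nu>. \<forall>v \<in> gen_eigenspace (bracket z) \<nu>. D v = \<phi> \<nu> *s v)
        \<longrightarrow> op_trace (\<lambda>x. bracket z (D x)) = (\<Sum>b\<in>B. c b * \<phi> (c b))"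
      by (rule ex_trace_formula[OF linear_bracket]) (rule that; assumption)
    have "finite (c ` B - {0})" "0 \<notin> c ` B - {0}" using B(3) by auto
    then obtain f :: "'k \<Rightarrow> rat" where f: "\<And>a b. f (a + b) = f a + f b"
      "\<And>q a. f (of_rat q * a) = q * f a" "\<And>s. s \<in> c ` B - {0} \<Longrightarrow> f s \<noteq> 0"
      using ex_additive_rat_nonzero by metis
    let ?\<phi> = "\<lambda>a. of_rat (f a) :: 'k"
    obtain D where D: "linear_op D" "\<forall>\<nu>. \<forall>v \<in> gen_eigenspace (bracket z) \<nu>. D v = ?\<phi> \<nu> *s v"
      using ex_diagonal_op[OF linear_bracket, of z ?\<phi>] by blast
    have der: "D (bracket u v) = bracket (D u) v + bracket u (D v)" for u v
      by (rule diagonal_op_derivation[OF D(1), where \<phi> = ?\<phi>])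
        (use D(2) in \<open>auto simp: f of_rat_add\<close>)
    \<comment> \<open>For w = [x, y] with x in \<open>?S\<close>, cyclicity gives tr(ad w D) = tr(ad
      x (ad y D - D ad y)) = - tr(ad x ad(D y)), a Killing value of x. This is why z is taken from
      [S, L] and not from S.\<close>
    have "op_trace (\<lambda>v. bracket w (D v)) = 0" if "w \<in> ?J" for w
      using that
    proof (induction rule: span_induct_alt)
      case base
      show ?case using op_trace_scale[of 0 "\<lambda>_. 0"] by (simp add: bracket_simps)
    next
      case (step a w w')
      then obtain x y where xy: "w = bracket x y" "x \<in> ?S" by blast
      have "op_trace (\<lambda>v. bracket y (bracket x (D v))) = op_trace (\<lambda>v. bracket x (D (bracket y v)))"
        by (rule op_trace_commute[OF linear_bracket linear_op_compose[OF linear_bracket D(1)]])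
      then have "op_trace (\<lambda>v. bracket w (D v))
          = op_trace (\<lambda>v. bracket x (bracket y (D v))) - op_trace (\<lambda>v. bracket x (D (bracket y v)))"
        by (simp add: xy bracket_bracket op_trace_diff)
      also have "\<dots> = - killing x (D y)"
        by (simp add: der killing_def bracket_simps op_trace_add)
      finally have "op_trace (\<lambda>v. bracket w (D v)) = 0" using xy by simp
      then show ?case using step by (simp add: bracket_simps op_trace_add op_trace_scale)
    qed
    from this[OF that] have "op_trace (\<lambda>v. bracket z (D v)) = 0" .
    moreover have "op_trace (\<lambda>v. bracket z (D v)) = (\<Sum>b\<in>B. c b * ?\<phi> (c b))"
      by (rule B(5)[rule_format, OF D(1)]) (use D(2) in blast)
    ultimately have "(\<Sum>b\<in>B. c b * ?\<phi> (c b)) = 0" by simp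
    then have "f (\<Sum>b\<in>B. c b * ?\<phi> (c b)) = 0" using f(2)[of 0 0] by simp
    moreover have "f (\<Sum>b\<in>A. c b * ?\<phi> (c b)) = (\<Sum>b\<in>A. f (c b) * f (c b))" if "finite A" for A
      using that
    proof (induction A rule: finite_induct)
      case empty
      then show ?case using f(2)[of 0 0] by simp
    next
      case (insert b A)
      then show ?case using f(2)[of "f (c b)" "c b"] by (simp add: f(1) mult.commute)
    qed
    ultimately have "(\<Sum>b\<in>B. f (c b) * f (c b)) = 0" using B(3) by simp
    then have "\<forall>b\<in>B. f (c b) = 0" using B(3) by (simp add: sum_nonneg_eq_0_iff)
    then have "\<forall>b\<in>B. c b = 0" using f(3) by blast
    then have "B \<subseteq> gen_eigenspace (bracket z) 0" using B(4) by force
    then have "span B \<subseteq> gen_eigenspace (bracket z) 0"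
      by (rule span_minimal[OF _ subspace_gen_eigenspace[OF linear_bracket]])
    then show ?thesis using B(2) by (auto simp: locally_nilpotent_iff)
  qed
  \<comment> \<open>Since [S, L] vanishes, x is central, and the centre is zero as well.\<close>
  ultimately have J0: "?J = {0}" by (rule ad_nilpotent_ideal_eq_0)
  have "bracket y x = 0" for y
  proof -
    have "bracket x y \<in> ?J" using assms by (intro span_base) blast
    then show ?thesis using J0 bracket_eq_0_commute by blast
  qed
  then show ?thesis by (rule central_eq_0)
qed

text \<open>A functional is encoded as the vector whose coordinates are its values on the basis. The
  map from d to its Killing functional then becomes an endomorphism \<open>?F\<close>; nondegeneracy
  makes it injective, hence surjective.\<close>

lemma killing_represents:
  assumes "\<And>x y. l (x + y) = l x + l y" "\<And>c x. l (c *s x) = c * l x"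
  shows "\<exists>d. \<forall>x. killing d x = l x"
proof -
  let ?F = "\<lambda>d. \<Sum>b\<in>some_basis. killing d b *s b"
  have ext: "killing d x = m x" if "\<And>b. b \<in> some_basis \<Longrightarrow> killing d b = m b"
    and m: "\<And>x y. m (x + y) = m x + m y" "\<And>c x. m (c *s x) = c * m x" for d x m
  proof -
    have "x \<in> span some_basis" by (simp add: some_basis)
    then show ?thesis
    proof (induction rule: span_induct_alt)
      case base
      show ?case using m(2)[of 0 0] by (simp add: killing_simps)
    qed (simp add: killing_simps that)
  qed
  have F: "linear_op ?F"
    by (rule linear_opI)
      (simp_all add: killing_simps scale_left_distrib sum.distrib scale_sum_right)
  have coeff: "g b = h b" if "(\<Sum>b\<in>some_basis. g b *s b) = (\<Sum>b\<in>some_basis. h b *s b)" "b \<in> some_basis"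
    for g h b
  proof -
    have "(\<Sum>b\<in>some_basis. (g b - h b) *s b) = 0"
      using that(1) by (simp add: scale_left_diff_distrib sum_subtractf)
    then have "g b - h b = 0"
      using independentD[OF some_basis(1) finite_Basis subset_refl, of "\<lambda>b. g b - h b"] that(2) by simp
    then show ?thesis by simp
  qed
  have "x = y" if "?F x = ?F y" for x y
  proof -
    have "killing (x - y) b = 0" if "b \<in> some_basis" for b
      using coeff[OF \<open>?F x = ?F y\<close> that] by (simp add: killing_simps)
    then have "killing (x - y) z = 0" for z
      by (rule ext[of _ "\<lambda>_. 0"]) auto
    then show ?thesis using killing_nondegenerate[of "x - y"] by simp
  qed
  then have "inj ?F" by (rule injI)
  with F have "surj ?F" by (rule linear_inj_imp_surj)
  then obtain d where d: "(\<Sum>b\<in>some_basis. l b *s b) = ?F d"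
    using surjD[of ?F "\<Sum>b\<in>some_basis. l b *s b"] by blast
  have "killing d b = l b" if "b \<in> some_basis" for b
    using d[symmetric] that by (rule coeff)
  then have "killing d x = l x" for x by (rule ext[of d l x]) (simp_all add: assms)
  then show ?thesis by blast
qed

text \<open>Let d represent the functional tr(D ad x). Then E = D - ad d is a derivation with tr(E
  ad x) = 0 for all x, and from ad(E x) = [E, ad x] the Killing value of E x and y is tr(E ad
  [x, y]) = 0.\<close>

lemma derivation_inner:
  assumes D: "linear_op D" "\<And>u v. D (bracket u v) = bracket (D u) v + bracket u (D v)"
  shows "\<exists>d. \<forall>x. D x = bracket d x"
proof -
  have "\<exists>d. \<forall>x. killing d x = op_trace (\<lambda>v. D (bracket x v))"
    by (rule killing_represents)
      (simp_all add: linear_opD[OF D(1)] bracket_simps op_trace_add op_trace_scale)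
  then obtain d where d: "\<And>x. killing d x = op_trace (\<lambda>v. D (bracket x v))" by blast
  let ?E = "\<lambda>v. D v - bracket d v"
  have E: "linear_op ?E" by (intro linear_op_diff D linear_bracket)
  have tr: "op_trace (\<lambda>v. ?E (bracket x v)) = 0" for x
    using d[of x] by (simp add: op_trace_diff killing_def)
  have E_der: "bracket (?E x) v = ?E (bracket x v) - bracket x (?E v)" for x v
    by (simp add: D(2) bracket_simps bracket_leibniz[of d])
  have "killing (?E x) y = 0" for x y
  proof -
    have "op_trace (\<lambda>v. bracket x (?E (bracket y v))) = op_trace (\<lambda>v. ?E (bracket y (bracket x v)))"
      by (rule op_trace_commute[OF linear_bracket linear_op_compose[OF E linear_bracket]])
    then have "killing (?E x) y
        = op_trace (\<lambda>v. ?E (bracket x (bracket y v)) - ?E (bracket y (bracket x v)))"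
      unfolding killing_def E_der by (simp only: op_trace_diff)
    also have "\<dots> = op_trace (\<lambda>v. ?E (bracket (bracket x y) v))"
      by (simp only: bracket_bracket linear_opD(5)[OF E])
    finally show ?thesis by (simp only: tr)
  qed
  then have "?E x = 0" for x by (rule killing_nondegenerate)
  then show ?thesis by (intro exI[of _ d]) simp
qed

end

section \<open>Tori and semisimple parts\<close>

context semisimple_lie_algebra_char0
begin

lemma span_eigenspaces:
  assumes "ad_semisimple x"
  shows "span (\<Union>c. eigenspace (bracket x) c) = UNIV"
proof -
  obtain B where B: "span B = UNIV" "\<And>b. b \<in> B \<Longrightarrow> \<exists>c. bracket x b = c *s b"
    using assms unfolding ad_semisimple_def by blast
  have "B \<subseteq> (\<Union>c. eigenspace (bracket x) c)"
    using B(2) by (auto simp: eigenspace_def)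
  then have "span B \<subseteq> span (\<Union>c. eigenspace (bracket x) c)" by (rule span_mono)
  then show ?thesis using B(1) by (simp add: top.extremum_unique)
qed

lemma ad_semisimpleI:
  assumes "span (\<Union>c. eigenspace (bracket x) c) = UNIV"
  shows "ad_semisimple x"
proof -
  obtain B where B: "B \<subseteq> (\<Union>c. eigenspace (bracket x) c)" "independent B"
    "(\<Union>c. eigenspace (bracket x) c) \<subseteq> span B"
    using maximal_independent_subset[of "\<Union>c. eigenspace (bracket x) c"] by metis
  have "span (\<Union>c. eigenspace (bracket x) c) \<subseteq> span B"
    using B(3) by (intro span_minimal) auto
  moreover have "\<forall>b\<in>B. \<exists>c. bracket x b = c *s b" using B(1) by (auto simp: eigenspace_def)
  ultimately show ?thesis using assms B(2) unfolding ad_semisimple_def by blast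
qed

lemma independent_family_eigenspace:
  assumes "linear_op T"
  shows "independent_family UNIV (eigenspace T)"
  unfolding independent_family_def
proof (intro allI impI ballI)
  fix A u c
  assume "finite A" "\<forall>c\<in>A. u c \<in> eigenspace T c" "(\<Sum>c\<in>A. u c) = 0" "c \<in> A"
  then show "u c = 0"
    using eigenspace_subset_gen[OF assms]
    by (intro independent_familyD[OF independent_family_gen_eigenspace[OF assms]]) auto
qed

lemma eigen_decomposition:
  assumes "ad_semisimple x"
  obtains A u where "finite A" "\<And>c. c \<in> A \<Longrightarrow> u c \<in> eigenspace (bracket x) c" "v = (\<Sum>c\<in>A. u c)"
proof -
  have "v \<in> span (\<Union>c. eigenspace (bracket x) c)" using span_eigenspaces[OF assms] by simp
  from in_span_UN_sum[OF this subspace_eigenspace[OF linear_bracket]] obtain A u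
    where "finite A" "\<forall>c\<in>A. u c \<in> eigenspace (bracket x) c" "v = (\<Sum>c\<in>A. u c)"
    by blast
  then show ?thesis by (intro that) auto
qed

text \<open>A common eigenvector of \<open>F\<close> is split into eigencomponents of the new x.
  Each y in \<open>F\<close> commutes with x and so preserves the eigenspaces of ad x; uniqueness of
  components shows that every component keeps the eigenvalue of y.\<close>

lemma simultaneous_eigenvectors_span:
  assumes "finite F" "\<And>x. x \<in> F \<Longrightarrow> ad_semisimple x"
    "\<And>x y. x \<in> F \<Longrightarrow> y \<in> F \<Longrightarrow> bracket x y = 0"
  shows "span {v. \<forall>x\<in>F. \<exists>c. bracket x v = c *s v} = UNIV"
  using assms
proof (induction F rule: finite_induct)
  case (insert x F)
  let ?S = "\<lambda>F. {v. \<forall>x\<in>F. \<exists>c. bracket x v = c *s v}"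
  have IH: "span (?S F) = UNIV" using insert by blast
  have "v \<in> span (?S (insert x F))" if v: "v \<in> ?S F" for v
  proof -
    obtain A u where u: "finite A" "\<And>c. c \<in> A \<Longrightarrow> u c \<in> eigenspace (bracket x) c" "v = (\<Sum>c\<in>A. u c)"
      using eigen_decomposition[of x v] insert.prems by blast
    have uS: "u c \<in> ?S (insert x F)" if c: "c \<in> A" for c
    proof -
      have "\<exists>d. bracket y (u c) = d *s u c" if y: "y \<in> F" for y
      proof -
        obtain d where d: "bracket y v = d *s v" using v y by blast
        let ?w = "\<lambda>c. bracket y (u c) - d *s u c"
        have "?w c \<in> eigenspace (bracket x) c" if "c \<in> A" for c
          using u(2)[OF that] insert.prems(2)[of x y] y
          by (simp add: eigenspace_def bracket_simps bracket_leibniz[of x y] scale_right_diff_distrib mult.commute)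
        moreover have "(\<Sum>c\<in>A. ?w c) = 0"
          using d by (simp add: u(3) bracket_simps sum_subtractf scale_sum_right)
        ultimately have "?w c = 0"
          using independent_familyD[OF independent_family_eigenspace[OF linear_bracket] u(1), of ?w x c] c
          by simp
        then show ?thesis by auto
      qed
      moreover have "\<exists>d. bracket x (u c) = d *s u c" using u(2)[OF c] by (auto simp: eigenspace_def)
      ultimately show ?thesis by blast
    qed
    show ?thesis unfolding u(3) by (intro span_sum span_base) (rule uS)
  qed
  then have "span (?S F) \<subseteq> span (?S (insert x F))" by (intro span_minimal) auto
  then show ?case using IH by auto
qed simp

text \<open>T - c deletes the component for c and rescales the one for d by the nonzero factor d -
  c, which drives the induction.\<close>

lemma eigen_components_in_subspace:
  assumes T: "linear_op T" and W: "subspace W" "\<And>w. w \<in> W \<Longrightarrow> T w \<in> W"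
    and "finite A" "\<And>c. c \<in> A \<Longrightarrow> u c \<in> eigenspace T c" "(\<Sum>c\<in>A. u c) \<in> W"
  shows "\<forall>c\<in>A. u c \<in> W"
  using assms(4-)
proof (induction A arbitrary: u rule: finite_induct)
  case (insert c A)
  let ?w = "\<lambda>d. (d - c) *s u d"
  have "shift T c (\<Sum>d\<in>insert c A. u d) \<in> W"
    using insert.prems W by (simp add: shift_def subspace_diff subspace_scale)
  moreover have "shift T c (\<Sum>d\<in>insert c A. u d) = (\<Sum>d\<in>insert c A. ?w d)"
    unfolding shift_simps(6)[OF T]
    using insert.prems(1) by (intro sum.cong) (auto simp: shift_def eigenspace_def scale_left_diff_distrib)
  ultimately have "(\<Sum>d\<in>A. ?w d) \<in> W" using insert.hyps by simp
  moreover have "?w d \<in> eigenspace T d" if "d \<in> A" for d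
    using insert.prems(1) that by (intro subspace_scale subspace_eigenspace[OF T]) auto
  ultimately have IH: "\<forall>d\<in>A. ?w d \<in> W" by (intro insert.IH) auto
  have uW: "u d \<in> W" if "d \<in> A" for d
  proof -
    have "inverse (d - c) *s ?w d \<in> W"
      by (rule subspace_scale[OF W(1)]) (use IH that in blast)
    moreover have "d \<noteq> c" using that insert.hyps by blast
    ultimately show ?thesis by simp
  qed
  have "(\<Sum>d\<in>A. u d) \<in> W" by (intro subspace_sum[OF W(1)]) (rule uW)
  then have "u c \<in> W"
    using insert.prems(2) insert.hyps subspace_diff[OF W(1), of "\<Sum>d\<in>insert c A. u d" "\<Sum>d\<in>A. u d"] by simp
  then show ?case using uW by blast
qed simp

lemma ad_semisimple_square_zero:
  assumes "ad_semisimple y" "bracket y (bracket y x) = 0"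
  shows "bracket y x = 0"
proof -
  obtain A u where u: "finite A" "\<And>c. c \<in> A \<Longrightarrow> u c \<in> eigenspace (bracket y) c" "x = (\<Sum>c\<in>A. u c)"
    using eigen_decomposition[OF assms(1), of x] by blast
  have e: "bracket y (u c) = c *s u c" if "c \<in> A" for c using u(2)[OF that] by (simp add: eigenspace_def)
  have "bracket y (bracket y x) = (\<Sum>c\<in>A. (c * c) *s u c)"
    using e by (simp add: u(3) bracket_simps)
  then have z: "(\<Sum>c\<in>A. (c * c) *s u c) = 0" using assms(2) by simp
  have "(c * c) *s u c = 0" if "c \<in> A" for c
    by (rule independent_familyD[OF independent_family_eigenspace[OF linear_bracket] u(1) _ _ z that])
      (auto intro: subspace_scale[OF subspace_eigenspace[OF linear_bracket]] u(2))
  then have "bracket y (u c) = 0" if "c \<in> A" for c using that e by auto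
  then show ?thesis by (simp add: u(3) bracket_simps)
qed

text \<open>If u in T satisfies [x, u] = c u, then (ad u)^2 x = 0. As ad u is diagonalizable it has
  the same kernel as its square, so [u, x] = 0. The eigencomponents of y are such elements, because
  T is stable under ad x.\<close>

lemma torus_abelian:
  assumes T: "torus T" and xy: "x \<in> T" "y \<in> T"
  shows "bracket x y = 0"
proof -
  have sT: "subspace T" and bT: "\<And>x y. x \<in> T \<Longrightarrow> y \<in> T \<Longrightarrow> bracket x y \<in> T"
    and ss: "\<And>x. x \<in> T \<Longrightarrow> ad_semisimple x"
    using T by (auto simp: torus_def subalgebra_def)
  obtain A u where u: "finite A" "\<And>c. c \<in> A \<Longrightarrow> u c \<in> eigenspace (bracket x) c" "y = (\<Sum>c\<in>A. u c)"
    using eigen_decomposition[OF ss[OF xy(1)], of y] by blast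
  have uT: "\<forall>c\<in>A. u c \<in> T"
    by (rule eigen_components_in_subspace[OF linear_bracket sT _ u(1,2)]) (use bT xy u(3) in auto)
  have "bracket x (u c) = 0" if c: "c \<in> A" for c
  proof -
    have e: "bracket x (u c) = c *s u c" using u(2)[OF c] by (simp add: eigenspace_def)
    then have "bracket (u c) x = - (c *s u c)" using bracket_skew by metis
    then have "bracket (u c) (bracket (u c) x) = 0" by (simp add: bracket_simps bracket_self)
    then have "bracket (u c) x = 0" using ad_semisimple_square_zero ss uT c by blast
    then show ?thesis using bracket_eq_0_commute by blast
  qed
  then show ?thesis by (simp add: u(3) bracket_simps)
qed

lemma torus_extend:
  assumes H: "torus H" and y: "ad_semisimple y" "\<And>h. h \<in> H \<Longrightarrow> bracket y h = 0"
  shows "torus {h + z | h z. h \<in> H \<and> z \<in> span {y}}" (is "torus ?T")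
proof -
  have sH: "subspace H" using H by (auto simp: torus_def subalgebra_def)
  have hy: "bracket h y = 0" if "h \<in> H" for h using y(2)[OF that] bracket_eq_0_commute by blast
  have sT: "subspace ?T" using sH by (intro subspace_sums) auto
  have el: "\<exists>h c. h \<in> H \<and> t = h + c *s y" if "t \<in> ?T" for t
    using that by (auto simp: span_singleton)
  have "bracket s t = 0" if "s \<in> ?T" "t \<in> ?T" for s t
  proof -
    obtain h c h' c' where "h \<in> H" "s = h + c *s y" "h' \<in> H" "t = h' + c' *s y"
      using el[OF \<open>s \<in> ?T\<close>] el[OF \<open>t \<in> ?T\<close>] by blast
    then show ?thesis
      using torus_abelian[OF H] hy y(2) by (simp add: bracket_simps bracket_self)
  qed
  then have "subalgebra ?T" using sT subspace_0[OF sT] unfolding subalgebra_def by simp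
  moreover have "ad_semisimple t" if t: "t \<in> ?T" for t
  proof -
    obtain h c where hc: "h \<in> H" "t = h + c *s y" using el[OF t] by blast
    let ?S = "{v. \<forall>x\<in>{h, y}. \<exists>c. bracket x v = c *s v}"
    have "span ?S = UNIV"
    proof (rule simultaneous_eigenvectors_span)
      show "ad_semisimple x" if "x \<in> {h, y}" for x using that y(1) hc H by (auto simp: torus_def)
      show "bracket x x' = 0" if "x \<in> {h, y}" "x' \<in> {h, y}" for x x'
        using that hy y(2) hc by (auto simp: bracket_self)
    qed simp
    moreover have "?S \<subseteq> (\<Union>c. eigenspace (bracket t) c)"
    proof
      fix v assume "v \<in> ?S"
      then obtain a b where "bracket h v = a *s v" "bracket y v = b *s v" by auto
      then have "bracket t v = (a + c * b) *s v"
        by (simp add: hc bracket_simps scale_left_distrib)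
      then show "v \<in> (\<Union>c. eigenspace (bracket t) c)" by (auto simp: eigenspace_def)
    qed
    ultimately show ?thesis using span_mono[of ?S] by (intro ad_semisimpleI) blast
  qed
  ultimately show ?thesis unfolding torus_def by blast
qed

lemma maximal_torus_centralizer:
  assumes "maximal_torus H" "ad_semisimple y" "\<And>h. h \<in> H \<Longrightarrow> bracket y h = 0"
  shows "y \<in> H"
proof -
  let ?T = "{h + z | h z. h \<in> H \<and> z \<in> span {y}}"
  have H: "torus H" using assms by (simp add: maximal_torus_def)
  have "torus ?T" by (rule torus_extend[OF H assms(2,3)])
  moreover have "x \<in> ?T" if "x \<in> H" for x
    using that span_zero[of "{y}"] by (intro CollectI exI[of _ x] exI[of _ 0]) simp
  ultimately have "?T = H" using assms(1) unfolding maximal_torus_def by blast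
  moreover have "0 \<in> H" using H subspace_0 by (simp add: torus_def subalgebra_def)
  then have "y \<in> ?T" using span_base[of y "{y}"] by (intro CollectI exI[of _ 0] exI[of _ y]) simp
  ultimately show ?thesis by simp
qed

text \<open>The abstract Jordan decomposition. The operator with scalar \<nu> on each generalized
  eigenspace of ad x is a derivation, hence some ad s. Its kernel contains that of ad x, so s
  commutes with whatever x commutes with.\<close>

lemma ex_semisimple_part:
  obtains s where "ad_semisimple s" "locally_nilpotent (bracket (x - s))"
    "\<And>v. bracket x v = 0 \<Longrightarrow> bracket s v = 0"
proof -
  let ?G = "gen_eigenspace (bracket x)"
  obtain D where D: "linear_op D" "\<forall>\<nu>. \<forall>v \<in> ?G \<nu>. D v = \<nu> *s v"
    using ex_diagonal_op[OF linear_bracket, of x "\<lambda>a. a"] by blast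
  have "D (bracket u v) = bracket (D u) v + bracket u (D v)" for u v
    by (rule diagonal_op_derivation[OF D(1), where \<phi> = "\<lambda>a. a"]) (use D(2) in auto)
  then obtain s where s: "\<And>v. D v = bracket s v" using derivation_inner[OF D(1)] by blast
  have sG: "bracket s v = \<nu> *s v" if "v \<in> ?G \<nu>" for v \<nu>
    using D(2) that s by simp
  have "span (\<Union>\<nu>. ?G \<nu>) \<subseteq> span (\<Union>c. eigenspace (bracket s) c)"
    by (rule span_mono) (auto simp: eigenspace_def sG)
  then have 1: "ad_semisimple s"
    using span_gen_eigenspaces[OF linear_bracket, of x] by (intro ad_semisimpleI) auto
  have "?G \<nu> \<subseteq> gen_eigenspace (bracket (x - s)) 0" for \<nu>
  proof
    fix v assume v: "v \<in> ?G \<nu>"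
    then obtain n where n: "(shift (bracket x) \<nu> ^^ n) v = 0" by (auto simp: gen_eigenspace_def)
    have "(bracket (x - s) ^^ k) v = (shift (bracket x) \<nu> ^^ k) v" for k
    proof (induction k)
      case (Suc k)
      have "(shift (bracket x) \<nu> ^^ k) v \<in> ?G \<nu>"
        using shift_pow_gen_eigenspace[OF linear_bracket v] .
      from sG[OF this] have "bracket (x - s) ((shift (bracket x) \<nu> ^^ k) v)
          = shift (bracket x) \<nu> ((shift (bracket x) \<nu> ^^ k) v)"
        by (simp only: bracket_simps shift_def)
      then show ?case using Suc by simp
    qed simp
    then show "v \<in> gen_eigenspace (bracket (x - s)) 0" using n by (auto simp: gen_eigenspace_def)
  qed
  then have "span (\<Union>\<nu>. ?G \<nu>) \<subseteq> gen_eigenspace (bracket (x - s)) 0"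
    by (intro span_minimal subspace_gen_eigenspace[OF linear_bracket]) blast
  then have 2: "locally_nilpotent (bracket (x - s))"
    using span_gen_eigenspaces[OF linear_bracket, of x] by (auto simp: locally_nilpotent_iff)
  have 3: "bracket s v = 0" if "bracket x v = 0" for v
    using that sG[of v 0] eigenspace_subset_gen[OF linear_bracket, of x 0]
    by (auto simp: eigenspace_def)
  show ?thesis by (rule that[OF 1 2 3])
qed

text \<open>ad n and ad z commute, so their product inherits nilpotency from ad n and has trace
  0.\<close>

lemma killing_nilpotent_commuting:
  assumes n: "locally_nilpotent (bracket n)" and c: "bracket n z = 0"
  shows "killing n z = 0"
proof -
  have comm: "bracket n (bracket z v) = bracket z (bracket n v)" for v
    using bracket_leibniz[of n z v] c by (simp add: bracket_simps)
  let ?f = "\<lambda>v. bracket n (bracket z v)"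
  have comm_pow: "bracket n ((bracket z ^^ k) v) = (bracket z ^^ k) (bracket n v)" for k v
    by (induction k) (simp_all add: comm)
  have pow: "(?f ^^ k) v = (bracket z ^^ k) ((bracket n ^^ k) v)" for k v
  proof (induction k)
    case (Suc k)
    have "(?f ^^ Suc k) v = bracket n ((bracket z ^^ Suc k) ((bracket n ^^ k) v))"
      using Suc by simp
    also have "\<dots> = (bracket z ^^ Suc k) (bracket n ((bracket n ^^ k) v))" by (rule comm_pow)
    finally show ?case by simp
  qed simp
  have "locally_nilpotent ?f"
    unfolding locally_nilpotent_def
  proof
    fix v
    obtain k where "(bracket n ^^ k) v = 0" using n by (auto simp: locally_nilpotent_def)
    then have "(?f ^^ k) v = 0"
      by (simp add: pow linear_opD(3)[OF linear_op_funpow[OF linear_bracket]])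
    then show "\<exists>k. (?f ^^ k) v = 0" by blast
  qed
  then show ?thesis
    unfolding killing_def by (rule op_trace_locally_nilpotent[OF linear_bracket_bracket])
qed

text \<open>For \<open>a = 0\<close> this also covers Heisenberg triples, where it forces \<open>\<mu> = 0\<close>.\<close>

lemma highest_weight:
  assumes ef: "bracket e f = h" and hf: "bracket h f = - (a *s f)"
    and v: "bracket e v = 0" "bracket h v = \<mu> *s v" "v \<noteq> 0" and n: "(bracket f ^^ n) v = 0"
  shows "\<exists>k :: nat. 2 * \<mu> = a * of_nat k"
proof -
  let ?v = "\<lambda>k. (bracket f ^^ k) v"
  have hv: "bracket h (?v k) = (\<mu> - a * of_nat k) *s ?v k" for k
  proof (induction k)
    case (Suc k)
    have "bracket h (?v (Suc k)) = bracket (bracket h f) (?v k) + bracket f (bracket h (?v k))"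
      using bracket_leibniz[of h f "?v k"] by simp
    also have "\<dots> = (\<mu> - a * of_nat (Suc k)) *s ?v (Suc k)"
      unfolding hf Suc by (simp add: bracket_simps scale_left_diff_distrib scale_left_distrib algebra_simps)
    finally show ?case .
  qed (simp add: v)
  \<comment> \<open>This is e f^(k+1) v = (k+1) (\<mu> - a k / 2) f^k v, doubled to avoid fractions.
    At the last nonzero f^k v the left side vanishes, and k+1 cancels in characteristic 0.\<close>
  have ev: "2 *s bracket e (?v (Suc k)) = (of_nat (Suc k) * (2 * \<mu> - a * of_nat k)) *s ?v k" for k
  proof (induction k)
    case 0
    have "bracket e (bracket f v) = \<mu> *s v" using bracket_leibniz[of e f v] v ef by (simp add: bracket_simps)
    then show ?case by simp
  next
    case (Suc k)
    have "bracket e (?v (Suc (Suc k))) = bracket h (?v (Suc k)) + bracket f (bracket e (?v (Suc k)))"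
      using bracket_leibniz[of e f "?v (Suc k)"] ef by simp
    then have "2 *s bracket e (?v (Suc (Suc k)))
        = 2 *s bracket h (?v (Suc k)) + bracket f (2 *s bracket e (?v (Suc k)))"
      by (simp add: scale_right_distrib bracket_simps)
    also have "\<dots> = (2 * (\<mu> - a * of_nat (Suc k))) *s ?v (Suc k)
        + (of_nat (Suc k) * (2 * \<mu> - a * of_nat k)) *s ?v (Suc k)"
      unfolding Suc hv by (simp add: bracket_simps)
    also have "\<dots> = (of_nat (Suc (Suc k)) * (2 * \<mu> - a * of_nat (Suc k))) *s ?v (Suc k)"
      by (simp only: scale_left_distrib[symmetric]) (simp add: algebra_simps)
    finally show ?case .
  qed
  have ex: "\<exists>n. ?v n = 0" using n by blast
  define m where "m = (LEAST n. ?v n = 0)"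
  have m: "?v m = 0" unfolding m_def using ex by (rule LeastI_ex)
  then have "m \<noteq> 0" using v(3) by (metis funpow_0)
  then obtain k where k: "m = Suc k" by (metis not0_implies_Suc)
  have "?v k \<noteq> 0" using not_less_Least[of k "\<lambda>n. ?v n = 0"] k unfolding m_def by simp
  moreover have "(of_nat (Suc k) * (2 * \<mu> - a * of_nat k)) *s ?v k = 0"
    using ev[of k] m unfolding k by (simp only: bracket_simps scale_zero_right)
  ultimately have "2 * \<mu> - a * of_nat k = 0" by (simp del: of_nat_Suc)
  then show ?thesis by (intro exI[of _ k]) simp
qed

end

section \<open>Root spaces\<close>

locale semisimple_with_torus = semisimple_lie_algebra_char0 scale bracket
  for scale :: "'k::{alg_closed_field, field_char_0} \<Rightarrow> 'a::ab_group_add \<Rightarrow> 'a" (infixr \<open>*s\<close> 75)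
    and bracket :: "'a \<Rightarrow> 'a \<Rightarrow> 'a" +
  fixes H :: "'a set"
  assumes maximal_torus_H: "maximal_torus H"
begin

lemma torus_H: "torus H"
  using maximal_torus_H by (simp add: maximal_torus_def)

lemma subspace_H: "subspace H"
  using torus_H by (simp add: torus_def subalgebra_def)

lemma H_abelian: "h \<in> H \<Longrightarrow> h' \<in> H \<Longrightarrow> bracket h h' = 0"
  by (rule torus_abelian[OF torus_H])

lemma dual_add: "\<alpha> \<in> dual H \<Longrightarrow> \<beta> \<in> dual H \<Longrightarrow> \<alpha> + \<beta> \<in> dual H"
  by (auto simp: dual_def algebra_simps)

lemma dual_uminus: "\<alpha> \<in> dual H \<Longrightarrow> - \<alpha> \<in> dual H"
  by (auto simp: dual_def)

lemma dual_zero: "0 \<in> dual H"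
  by (auto simp: dual_def)

lemma dual_eqI:
  assumes "\<alpha> \<in> dual H" "\<beta> \<in> dual H" "\<And>h. h \<in> H \<Longrightarrow> \<alpha> h = \<beta> h"
  shows "\<alpha> = \<beta>"
proof
  fix h show "\<alpha> h = \<beta> h" using assms by (cases "h \<in> H") (auto simp: dual_def)
qed

lemma root_spaceD: "x \<in> root_space H \<alpha> \<Longrightarrow> h \<in> H \<Longrightarrow> bracket h x = \<alpha> h *s x"
  by (simp add: root_space_def)

lemma subspace_root_space: "subspace (root_space H \<alpha>)"
  unfolding root_space_def
  by (auto intro!: subspaceI simp: bracket_simps scale_right_distrib mult.commute)

lemma bracket_root_space:
  assumes "x \<in> root_space H \<alpha>" "y \<in> root_space H \<beta>"
  shows "bracket x y \<in> root_space H (\<alpha> + \<beta>)"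
  using assms unfolding root_space_def
  by (simp add: bracket_leibniz[of _ x y] bracket_simps scale_left_distrib)

text \<open>Distinct weights differ at some h in H, and ad h - \<alpha>(h) then removes the
  component for \<alpha>. The element h is chosen anew for each \<beta> whose component is to
  vanish.\<close>

lemma independent_family_root_space: "independent_family (dual H) (root_space H)"
  unfolding independent_family_def
proof (intro allI impI)
  fix A u
  assume "finite A" "A \<subseteq> dual H" "\<forall>\<alpha>\<in>A. u \<alpha> \<in> root_space H \<alpha>" "(\<Sum>\<alpha>\<in>A. u \<alpha>) = 0"
  then show "\<forall>\<alpha>\<in>A. u \<alpha> = 0"
  proof (induction A arbitrary: u rule: finite_induct)
    case (insert \<alpha> A)
    have "u \<beta> = 0" if \<beta>: "\<beta> \<in> A" for \<beta>
    proof -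
      have "\<alpha> \<noteq> \<beta>" using \<beta> insert.hyps by blast
      then obtain h where h: "h \<in> H" "\<alpha> h \<noteq> \<beta> h" using dual_eqI insert.prems(1) \<beta> by blast
      let ?w = "\<lambda>\<gamma>. (\<gamma> h - \<alpha> h) *s u \<gamma>"
      have "shift (bracket h) (\<alpha> h) (\<Sum>\<gamma>\<in>insert \<alpha> A. u \<gamma>) = (\<Sum>\<gamma>\<in>insert \<alpha> A. ?w \<gamma>)"
        unfolding shift_simps(6)[OF linear_bracket]
        using insert.prems(2) root_spaceD[OF _ h(1)]
        by (intro sum.cong) (auto simp: shift_def scale_left_diff_distrib)
      then have "(\<Sum>\<gamma>\<in>A. ?w \<gamma>) = 0"
        using insert.prems(3) insert.hyps by (simp add: shift_simps(3)[OF linear_bracket])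
      then have "\<forall>\<gamma>\<in>A. ?w \<gamma> = 0"
        using insert.prems(1,2) by (intro insert.IH) (auto intro: subspace_scale[OF subspace_root_space])
      then have "?w \<beta> = 0" using \<beta> by blast
      then show ?thesis using h by simp
    qed
    then show ?case using insert.prems(3) insert.hyps by simp
  qed simp
qed

text \<open>H is abelian and spanned by finitely many ad-semisimple elements, so common eigenvectors
  span. A nonzero eigenvector determines its eigenvalues, which makes them linear in h.\<close>

lemma span_root_spaces: "span (\<Union>\<alpha>\<in>dual H. root_space H \<alpha>) = UNIV"
proof -
  obtain F where F: "F \<subseteq> H" "independent F" "H \<subseteq> span F"
    using maximal_independent_subset[of H] by blast
  have "finite F" using F(2) by (rule finiteI_independent)
  let ?S = "{v. \<forall>x\<in>F. \<exists>c. bracket x v = c *s v}"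
  have S: "span ?S = UNIV"
    by (rule simultaneous_eigenvectors_span[OF \<open>finite F\<close>])
      (use F(1) torus_H in \<open>auto simp: torus_def intro!: H_abelian\<close>)
  have "v \<in> span (\<Union>\<alpha>\<in>dual H. root_space H \<alpha>)" if v: "v \<in> ?S" for v
  proof (cases "v = 0")
    case True
    then show ?thesis by (simp add: span_zero)
  next
    case False
    have "\<exists>c. bracket h v = c *s v" if "h \<in> span F" for h
      using that
    proof (induction rule: span_induct_alt)
      case base
      show ?case by (rule exI[of _ 0]) (simp add: bracket_simps)
    next
      case (step a x y)
      then obtain b c where "bracket x v = b *s v" "bracket y v = c *s v" using v by blast
      then show ?case
        by (intro exI[of _ "a * b + c"]) (simp add: bracket_simps scale_left_distrib)
    qed
    then have "\<forall>h. \<exists>c. h \<in> H \<longrightarrow> bracket h v = c *s v" using F(3) by blast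
    then obtain f where f: "\<And>h. h \<in> H \<Longrightarrow> bracket h v = f h *s v" by metis
    \<comment> \<open>f is arbitrary off H; resetting it to 0 there matches the convention for
      \<open>dual H\<close>.\<close>
    define \<alpha> where "\<alpha> h = (if h \<in> H then f h else 0)" for h
    have \<alpha>: "bracket h v = \<alpha> h *s v" if "h \<in> H" for h using f that by (simp add: \<alpha>_def)
    have cancel: "a = b" if "a *s v = b *s v" for a b using that False by simp
    have "\<alpha> \<in> dual H"
      unfolding dual_def
    proof (intro CollectI conjI ballI allI impI)
      fix x y assume xy: "x \<in> H" "y \<in> H"
      show "\<alpha> (x + y) = \<alpha> x + \<alpha> y"
        using \<alpha>[OF subspace_add[OF subspace_H xy]] \<alpha>[OF xy(1)] \<alpha>[OF xy(2)]
        by (intro cancel) (simp add: bracket_simps scale_left_distrib)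
    next
      fix c x assume x: "x \<in> H"
      show "\<alpha> (c *s x) = c * \<alpha> x"
        using \<alpha>[OF subspace_scale[OF subspace_H x, of c], symmetric] \<alpha>[OF x]
        by (intro cancel) (simp only: bracket_simps scale_scale)
    qed (simp add: \<alpha>_def)
    moreover have "v \<in> root_space H \<alpha>" using \<alpha> by (simp add: root_space_def)
    ultimately show ?thesis by (intro span_base) blast
  qed
  then have "span ?S \<subseteq> span (\<Union>\<alpha>\<in>dual H. root_space H \<alpha>)"
    by (intro span_minimal) auto
  then show ?thesis using S by auto
qed

lemma root_space_induct [case_names weight add]:
  assumes "\<And>\<alpha> v. \<alpha> \<in> dual H \<Longrightarrow> v \<in> root_space H \<alpha> \<Longrightarrow> v \<noteq> 0 \<Longrightarrow> P v"
    and "P 0" "\<And>c v w. P v \<Longrightarrow> P w \<Longrightarrow> P (c *s v + w)"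
  shows "P v"
proof -
  have "v \<in> span (\<Union>\<alpha>\<in>dual H. root_space H \<alpha>)" by (simp add: span_root_spaces)
  then show ?thesis
  proof (induction rule: span_induct_alt)
    case (step c x y)
    then have "P x" using assms(1,2) by blast
    then show ?case using assms(3) step by blast
  qed (rule assms(2))
qed

lemma killing_eq_0I:
  assumes "\<And>\<alpha> z. \<alpha> \<in> dual H \<Longrightarrow> z \<in> root_space H \<alpha> \<Longrightarrow> killing x z = 0"
  shows "x = 0"
proof (rule killing_nondegenerate)
  show "killing x z = 0" for z
    by (rule root_space_induct[of "\<lambda>z. killing x z = 0"]) (auto simp: killing_simps assms)
qed

lemma killing_root_space_orthogonal:
  assumes "\<alpha> \<in> dual H" "\<beta> \<in> dual H" "\<alpha> + \<beta> \<noteq> 0" and x: "x \<in> root_space H \<alpha>" and y: "y \<in> root_space H \<beta>"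
  shows "killing x y = 0"
proof -
  obtain h where h: "h \<in> H" "(\<alpha> + \<beta>) h \<noteq> 0"
    using dual_eqI[OF dual_add[OF assms(1,2)] dual_zero] assms(3) by (metis zero_fun_apply)
  have "killing (bracket h x) y = - killing (bracket x h) y"
    by (subst bracket_skew) (simp add: killing_simps)
  also have "\<dots> = - killing x (bracket h y)" by (simp only: killing_invariant)
  finally have "(\<alpha> h + \<beta> h) * killing x y = 0"
    by (simp add: root_spaceD[OF x h(1)] root_spaceD[OF y h(1)] killing_simps distrib_right)
  then show ?thesis using h by simp
qed

lemma H_subset_centralizer: "h \<in> H \<Longrightarrow> h \<in> root_space H 0"
  using H_abelian by (simp add: root_space_def)

text \<open>The semisimple part of x commutes with everything x commutes with, in particular with H,
  so maximality of the torus puts it into H.\<close>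

lemma centralizer_jordan:
  assumes x: "x \<in> root_space H 0"
  shows "\<exists>h\<in>H. locally_nilpotent (bracket (x - h)) \<and> x - h \<in> root_space H 0"
proof -
  obtain s where s: "ad_semisimple s" "locally_nilpotent (bracket (x - s))"
    "\<And>v. bracket x v = 0 \<Longrightarrow> bracket s v = 0"
    using ex_semisimple_part by blast
  have "bracket s h = 0" if "h \<in> H" for h
    using root_spaceD[OF x that] by (intro s(3)) (simp add: bracket_eq_0_commute)
  then have "s \<in> H" by (rule maximal_torus_centralizer[OF maximal_torus_H s(1)])
  then show ?thesis
    using s(2) subspace_diff[OF subspace_root_space x H_subset_centralizer] by blast
qed

lemma centralizer_commutes: "x \<in> root_space H 0 \<Longrightarrow> h \<in> H \<Longrightarrow> bracket x h = 0"
  using root_spaceD[of x 0 h] by (simp add: bracket_eq_0_commute)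

text \<open>
  The centralizer is \<open>H\<close> plus its ad-nilpotent elements. The latter are closed under addition, so
  the Killing form vanishes on them by polarization.
\<close>

lemma root_space_0: "root_space H 0 = H"
proof
  let ?C = "root_space H 0"
  show "H \<subseteq> ?C" using H_subset_centralizer by blast
  have orth: "killing x z = 0" if "x \<in> ?C" "\<alpha> \<in> dual H" "\<alpha> \<noteq> 0" "z \<in> root_space H \<alpha>" for x z \<alpha>
    using killing_root_space_orthogonal[OF dual_zero that(2) _ that(1,4)] that(3) by simp
  have NH: "killing n h = 0" if "n \<in> ?C" "locally_nilpotent (bracket n)" "h \<in> H" for n h
    using killing_nilpotent_commuting[OF that(2)] centralizer_commutes[OF that(1,3)] by blast
  have NN: "killing n n = 0" if "locally_nilpotent (bracket n)" for n
    using killing_nilpotent_commuting[OF that] bracket_self by blast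
  \<comment> \<open>By the decomposition, n + n' = h + m with h in H and m ad-nilpotent in the
    centralizer. As n, n' and m are orthogonal to H, so is h; being orthogonal also to the
    ad-nilpotent part of the centralizer and to all other root spaces, h is 0.\<close>
  have sum_nilpotent: "locally_nilpotent (bracket (n + n'))"
    if n: "n \<in> ?C" "locally_nilpotent (bracket n)" "n' \<in> ?C" "locally_nilpotent (bracket n')" for n n'
  proof -
    have "n + n' \<in> ?C" using n subspace_add[OF subspace_root_space] by blast
    then obtain h where h: "h \<in> H" "locally_nilpotent (bracket (n + n' - h))" "n + n' - h \<in> ?C"
      using centralizer_jordan by blast
    let ?m = "n + n' - h"
    have hH: "killing h h' = 0" if "h' \<in> H" for h'
      using NH[OF n(1,2) that] NH[OF n(3,4) that] NH[OF h(3,2) that] by (simp add: killing_simps)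
    have "killing h z = 0" if z: "\<alpha> \<in> dual H" "z \<in> root_space H \<alpha>" for \<alpha> z
    proof (cases "\<alpha> = 0")
      case True
      then obtain h' where h': "h' \<in> H" "locally_nilpotent (bracket (z - h'))" "z - h' \<in> ?C"
        using centralizer_jordan z by blast
      have "killing h (z - h') = 0" using NH[OF h'(3,2) h(1)] killing_commute by metis
      then show ?thesis using hH[OF h'(1)] by (simp add: killing_simps)
    next
      case False
      then show ?thesis using orth[OF H_subset_centralizer[OF h(1)] z(1) _ z(2)] by blast
    qed
    then have "h = 0" by (rule killing_eq_0I)
    then show ?thesis using h by simp
  qed
  show "?C \<subseteq> H"
  proof
    fix x assume x: "x \<in> ?C"
    then obtain h where h: "h \<in> H" "locally_nilpotent (bracket (x - h))" "x - h \<in> ?C"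
      using centralizer_jordan by blast
    let ?n = "x - h"
    have "killing ?n z = 0" if z: "\<alpha> \<in> dual H" "z \<in> root_space H \<alpha>" for \<alpha> z
    proof (cases "\<alpha> = 0")
      case True
      then obtain h' where h': "h' \<in> H" "locally_nilpotent (bracket (z - h'))" "z - h' \<in> ?C"
        using centralizer_jordan z by blast
      let ?n' = "z - h'"
      have "killing (?n + ?n') (?n + ?n') = 0"
        by (rule NN[OF sum_nilpotent[OF h(3,2) h'(3,2)]])
      then have "killing ?n ?n' + killing ?n' ?n = 0"
        using NN[OF h(2)] NN[OF h'(2)] by (simp only: killing_add_left killing_add_right) (simp add: add.commute)
      then have "2 * killing ?n ?n' = 0" using killing_commute[of ?n' ?n] by simp
      then have "killing ?n ?n' = 0" by simp
      then show ?thesis using NH[OF h(3,2) h'(1)] by (simp only: killing_diff_right) simp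
    next
      case False
      then show ?thesis using orth[OF h(3) z(1) _ z(2)] by blast
    qed
    then have "?n = 0" by (rule killing_eq_0I)
    then show "x \<in> H" using h by simp
  qed
qed

lemma finite_weights: "finite {\<alpha> \<in> dual H. root_space H \<alpha> \<noteq> {0}}" (is "finite ?W")
proof -
  have "\<forall>\<alpha>\<in>?W. \<exists>v. v \<in> root_space H \<alpha> \<and> v \<noteq> 0"
    using subspace_0[OF subspace_root_space] by blast
  from bchoice[OF this] obtain b where "\<forall>\<alpha>\<in>?W. b \<alpha> \<in> root_space H \<alpha> \<and> b \<alpha> \<noteq> 0" ..
  then have b: "\<And>\<alpha>. \<alpha> \<in> ?W \<Longrightarrow> b \<alpha> \<in> root_space H \<alpha>" "\<And>\<alpha>. \<alpha> \<in> ?W \<Longrightarrow> b \<alpha> \<noteq> 0"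
    by simp_all
  have ind: "independent_family ?W (root_space H)"
    using independent_family_root_space unfolding independent_family_def by blast
  have "independent (\<Union>\<alpha>\<in>?W. {b \<alpha>})"
    by (rule independent_UN[OF ind]) (use b subspace_root_space in auto)
  then have "finite (b ` ?W)" using finiteI_independent[of "b ` ?W"] by (simp add: UNION_singleton_eq_range)
  moreover have "inj_on b ?W"
  proof (rule inj_onI, rule ccontr)
    fix \<alpha> \<beta> assume ab: "\<alpha> \<in> ?W" "\<beta> \<in> ?W" "b \<alpha> = b \<beta>" "\<alpha> \<noteq> \<beta>"
    have "b \<alpha> \<in> span (\<Union>i\<in>{\<beta>}. root_space H i)" using b(1)[OF ab(2)] ab(3) by (auto intro: span_base)
    then have "b \<alpha> = 0"
      using independent_family_Int_span[OF ind, of "{\<beta>}" \<alpha> "b \<alpha>"] ab b(1)[OF ab(1)] subspace_root_space by blast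
    then show False using b(2) ab by blast
  qed
  ultimately show ?thesis by (rule finite_imageD)
qed

lemma finite_roots: "finite (roots H)"
  by (rule finite_subset[OF _ finite_weights]) (auto simp: roots_def)

lemma bracket_pow_root_space:
  assumes "x \<in> root_space H \<alpha>" "v \<in> root_space H \<beta>"
  shows "(bracket x ^^ n) v \<in> root_space H (\<lambda>h. \<beta> h + of_nat n * \<alpha> h)"
proof (induction n)
  case (Suc n)
  have "\<alpha> + (\<lambda>h. \<beta> h + of_nat n * \<alpha> h) = (\<lambda>h. \<beta> h + of_nat (Suc n) * \<alpha> h)"
    by (auto simp: algebra_simps)
  then show ?case using bracket_root_space[OF assms(1) Suc] by simp
qed (use assms in simp)

text \<open>The n-th power moves v to the weight \<beta> + n \<alpha>. In characteristic 0 these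
  weights are pairwise distinct, while only finitely many weights occur.\<close>

lemma bracket_pow_eq_0:
  assumes "\<alpha> \<in> dual H" "\<alpha> \<noteq> 0" "x \<in> root_space H \<alpha>" "\<beta> \<in> dual H" "v \<in> root_space H \<beta>"
  shows "\<exists>n. (bracket x ^^ n) v = 0"
proof (rule ccontr)
  assume nz: "\<not> ?thesis"
  let ?g = "\<lambda>n h. \<beta> h + of_nat n * \<alpha> h"
  have "?g n \<in> dual H" for n
    using assms(1,4) by (auto simp: dual_def algebra_simps)
  then have "range ?g \<subseteq> {\<alpha> \<in> dual H. root_space H \<alpha> \<noteq> {0}}"
    using bracket_pow_root_space[OF assms(3,5)] nz by blast
  then have "finite (range ?g)" using finite_weights finite_subset by blast
  moreover obtain h where "\<alpha> h \<noteq> 0" using assms(2) by (auto simp: fun_eq_iff)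
  then have "inj ?g" by (auto intro!: injI dest: fun_cong[of _ _ h])
  ultimately show False using finite_imageD by blast
qed

lemma last_nonzero_power:
  assumes "\<alpha> \<in> dual H" "\<alpha> \<noteq> 0" "x \<in> root_space H \<alpha>" "\<beta> \<in> dual H" "v \<in> root_space H \<beta>" "v \<noteq> 0"
  shows "\<exists>m. (bracket x ^^ m) v \<noteq> 0 \<and> bracket x ((bracket x ^^ m) v) = 0"
proof -
  let ?P = "\<lambda>n. (bracket x ^^ n) v = 0"
  have "?P (LEAST n. ?P n)" using bracket_pow_eq_0[OF assms(1-5)] by (rule LeastI_ex)
  moreover from this have "(LEAST n. ?P n) \<noteq> 0" using assms(6) by (metis funpow_0)
  then obtain m where m: "(LEAST n. ?P n) = Suc m" by (metis not0_implies_Suc)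
  moreover have "\<not> ?P m" using not_less_Least[of m ?P] m by simp
  ultimately show ?thesis by (intro exI[of _ m]) simp
qed

lemma ex_killing_dual:
  assumes "\<alpha> \<in> dual H" "x \<in> root_space H \<alpha>" "x \<noteq> 0"
  shows "\<exists>y\<in>root_space H (- \<alpha>). killing x y \<noteq> 0"
proof (rule ccontr)
  assume nz: "\<not> ?thesis"
  have "killing x z = 0" if "\<beta> \<in> dual H" "z \<in> root_space H \<beta>" for \<beta> z
  proof (cases "\<alpha> + \<beta> = 0")
    case True
    then have "\<beta> = - \<alpha>" by (simp add: eq_neg_iff_add_eq_0 add.commute)
    then show ?thesis using nz that by blast
  next
    case False
    then show ?thesis using killing_root_space_orthogonal[OF assms(1) that(1) _ assms(2) that(2)] by blast
  qed
  then show False using killing_eq_0I assms(3) by blast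
qed

section \<open>The subalgebra spanned by x, y and [x, y] for opposite root vectors\<close>

context
  fixes \<alpha> x y
  assumes \<alpha>: "\<alpha> \<in> dual H" "\<alpha> \<noteq> 0"
    and x: "x \<in> root_space H \<alpha>" and y: "y \<in> root_space H (- \<alpha>)" and xy: "killing x y \<noteq> 0"
begin

lemma coroot_in_H: "bracket x y \<in> H"
  using bracket_root_space[OF x y] root_space_0 by simp

lemma coroot_bracket: "bracket (bracket x y) x = \<alpha> (bracket x y) *s x"
  "bracket (bracket x y) y = - (\<alpha> (bracket x y) *s y)"
  using root_spaceD[OF x coroot_in_H] root_spaceD[OF y coroot_in_H] by simp_all

lemma ad_root_vector_nilpotent:
  assumes "\<beta> \<in> dual H" "v \<in> root_space H \<beta>"
  shows "\<exists>n. (bracket y ^^ n) v = 0"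
  by (rule bracket_pow_eq_0[OF dual_uminus[OF \<alpha>(1)] _ y assms]) (use \<alpha>(2) in simp)

text \<open>Otherwise x, y and h = [x, y] form a Heisenberg triple, and the highest weight argument
  with a = 0 makes every weight vanish at h. Then h is central, hence 0, although its Killing value
  with some h' in H is \<alpha>(h') \<open>killing x y\<close>, which is nonzero.\<close>

lemma root_coroot_nonzero: "\<alpha> (bracket x y) \<noteq> 0"
proof
  let ?h = "bracket x y"
  assume \<alpha>h: "\<alpha> ?h = 0"
  have \<beta>h: "\<beta> ?h = 0" if \<beta>: "\<beta> \<in> dual H" "v \<in> root_space H \<beta>" "v \<noteq> 0" for \<beta> v
  proof -
    obtain m where m: "(bracket x ^^ m) v \<noteq> 0" "bracket x ((bracket x ^^ m) v) = 0"
      using last_nonzero_power[OF \<alpha> x \<beta>] by blast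
    let ?w = "(bracket x ^^ m) v"
    let ?g = "\<lambda>h. \<beta> h + of_nat m * \<alpha> h"
    have w: "?w \<in> root_space H ?g" by (rule bracket_pow_root_space[OF x \<beta>(2)])
    have "?g \<in> dual H" using \<beta>(1) \<alpha>(1) by (auto simp: dual_def algebra_simps)
    then obtain n where n: "(bracket y ^^ n) ?w = 0" using ad_root_vector_nilpotent w by blast
    have "bracket ?h ?w = \<beta> ?h *s ?w" using root_spaceD[OF w coroot_in_H] \<alpha>h by simp
    then have "\<exists>k::nat. 2 * \<beta> ?h = 0 * of_nat k"
      using coroot_bracket(2) \<alpha>h m n by (intro highest_weight[of x y ?h 0 ?w]) auto
    then show ?thesis by simp
  qed
  have "bracket ?h v = 0" for v
    by (rule root_space_induct[of "\<lambda>v. bracket ?h v = 0"])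
      (auto simp: bracket_simps \<beta>h root_spaceD[OF _ coroot_in_H])
  then have "?h = 0" using central_eq_0 bracket_eq_0_commute by blast
  moreover obtain h where h: "h \<in> H" "\<alpha> h \<noteq> 0"
    using dual_eqI[OF \<alpha>(1) dual_zero] \<alpha>(2) by (metis zero_fun_apply)
  have "killing h ?h = \<alpha> h * killing x y"
    using killing_invariant[of h x y] root_spaceD[OF x h(1)] by (simp add: killing_simps)
  ultimately show False using h xy by (simp add: killing_simps)
qed

text \<open>With h = [x, y], the coroot of \<alpha> is h scaled by 2/\<alpha>(h); k is the value of
  \<beta> on it, stated without division.\<close>

lemma highest_weight_root:
  assumes "\<beta> \<in> dual H" "v \<in> root_space H \<beta>" "v \<noteq> 0" "bracket x v = 0"
  shows "\<exists>k::nat. 2 * \<beta> (bracket x y) = \<alpha> (bracket x y) * of_nat k"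
proof -
  obtain n where "(bracket y ^^ n) v = 0" using ad_root_vector_nilpotent[OF assms(1,2)] by blast
  then show ?thesis
    using coroot_bracket(2) assms(3,4) root_spaceD[OF assms(2) coroot_in_H]
    by (intro highest_weight[of x y _ _ v]) auto
qed

text \<open>[x', y] has weight 0, and for z in H invariance turns its Killing value with z into
  \<alpha>(z) \<open>killing x' y\<close>. So it is orthogonal to every root space.\<close>

lemma bracket_eq_0_if_orthogonal:
  assumes "x' \<in> root_space H \<alpha>" "killing x' y = 0"
  shows "bracket x' y = 0"
proof (rule killing_eq_0I)
  have H': "bracket x' y \<in> root_space H 0" using bracket_root_space[OF assms(1) y] by simp
  fix \<beta> z assume \<beta>: "\<beta> \<in> dual H" "z \<in> root_space H \<beta>"
  show "killing (bracket x' y) z = 0"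
  proof (cases "\<beta> = 0")
    case True
    then have z: "z \<in> H" using \<beta> root_space_0 by simp
    have "killing z (bracket x' y) = \<alpha> z * killing x' y"
      using killing_invariant[of z x' y] root_spaceD[OF assms(1) z] by (simp add: killing_simps)
    then show ?thesis using assms(2) killing_commute by simp
  next
    case False
    then show ?thesis using killing_root_space_orthogonal[OF dual_zero \<beta>(1) _ H' \<beta>(2)] by simp
  qed
qed

text \<open>Subtracting a multiple of x from x' leaves \<open>?z\<close> orthogonal to y, hence
  commuting with y. If nonzero, \<open>?z\<close> is a highest weight vector of weight -\<alpha>(h)
  for the opposite triple y, x, -h. Then -2 \<alpha>(h) = k \<alpha>(h) with k natural, which is
  impossible.\<close>

lemma root_space_multiple:
  assumes x': "x' \<in> root_space H \<alpha>"
  shows "\<exists>c. x' = c *s x"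
proof -
  let ?c = "killing x' y / killing x y"
  let ?z = "x' - ?c *s x"
  have z: "?z \<in> root_space H \<alpha>"
    using x x' subspace_root_space by (simp add: subspace_diff subspace_scale)
  have "killing ?z y = 0" using xy by (simp add: killing_simps)
  then have "bracket ?z y = 0" using bracket_eq_0_if_orthogonal z by blast
  then have yz: "bracket y ?z = 0" using bracket_eq_0_commute by blast
  let ?h = "bracket x y"
  have yx: "bracket y x = - ?h" by (rule bracket_skew)
  have "?z = 0"
  proof (rule ccontr)
    assume nz: "?z \<noteq> 0"
    obtain n where n: "(bracket x ^^ n) ?z = 0" using bracket_pow_eq_0[OF \<alpha> x \<alpha>(1) z] by blast
    have "bracket (- ?h) x = - (\<alpha> ?h *s x)" "bracket (- ?h) ?z = (- \<alpha> ?h) *s ?z"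
      using coroot_bracket(1) root_spaceD[OF z coroot_in_H] by (simp_all add: bracket_simps(10))
    then have "\<exists>k::nat. 2 * (- \<alpha> ?h) = \<alpha> ?h * of_nat k"
      by (rule highest_weight[OF yx _ yz _ nz n])
    then obtain k :: nat where k: "2 * (- \<alpha> ?h) = \<alpha> ?h * of_nat k" by blast
    have "\<alpha> ?h * of_nat (k + 2) = \<alpha> ?h * of_nat k - 2 * (- \<alpha> ?h)" by (simp add: algebra_simps)
    then have "\<alpha> ?h * of_nat (k + 2) = 0" unfolding k by simp
    then show False using root_coroot_nonzero of_nat_eq_0_iff[of "k + 2"] by (metis add_is_0 mult_eq_0_iff zero_neq_numeral)
  qed
  then show ?thesis by (intro exI[of _ ?c]) simp
qed

end

lemma root_space_abelian:
  assumes "\<alpha> \<in> dual H" "\<alpha> \<noteq> 0" "x \<in> root_space H \<alpha>" "x' \<in> root_space H \<alpha>"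
  shows "bracket x x' = 0"
proof (cases "x = 0")
  case False
  then obtain y where y: "y \<in> root_space H (- \<alpha>)" "killing x y \<noteq> 0" using ex_killing_dual assms by blast
  then obtain c where "x' = c *s x" using root_space_multiple[OF assms(1,2,3) y assms(4)] by blast
  then show ?thesis by (simp add: bracket_simps bracket_self)
qed (simp add: bracket_simps)

end

section \<open>Minimal generating sets of roots\<close>

context semisimple_with_torus
begin

lemma int_span_zero: "0 \<in> int_span S"
  unfolding int_span_def by (intro CollectI exI[of _ "{}"]) (auto simp: zero_fun_def)

lemma int_span_base: "\<alpha> \<in> S \<Longrightarrow> \<alpha> \<in> int_span S"
  unfolding int_span_def by (intro CollectI exI[of _ "{\<alpha>}"] exI[of _ "\<lambda>_. 1"]) auto

lemma int_span_add:
  assumes "\<alpha> \<in> int_span S" "\<beta> \<in> int_span S"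
  shows "\<alpha> + \<beta> \<in> int_span S"
proof -
  obtain A c B d where A: "finite A" "A \<subseteq> S" "\<alpha> = (\<lambda>h. \<Sum>\<gamma>\<in>A. of_int (c \<gamma>) * \<gamma> h)"
    and B: "finite B" "B \<subseteq> S" "\<beta> = (\<lambda>h. \<Sum>\<gamma>\<in>B. of_int (d \<gamma>) * \<gamma> h)"
    using assms unfolding int_span_def by blast
  define e where "e \<gamma> = (if \<gamma> \<in> A then c \<gamma> else 0) + (if \<gamma> \<in> B then d \<gamma> else 0)" for \<gamma>
  have "(\<alpha> + \<beta>) h = (\<Sum>\<gamma>\<in>A \<union> B. of_int (e \<gamma>) * \<gamma> h)" for h
  proof -
    have "(\<Sum>\<gamma>\<in>A. of_int (c \<gamma>) * \<gamma> h) = (\<Sum>\<gamma>\<in>A \<union> B. of_int (if \<gamma> \<in> A then c \<gamma> else 0) * \<gamma> h)"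
      using A(1) B(1) by (intro sum.mono_neutral_cong_left) auto
    moreover have "(\<Sum>\<gamma>\<in>B. of_int (d \<gamma>) * \<gamma> h) = (\<Sum>\<gamma>\<in>A \<union> B. of_int (if \<gamma> \<in> B then d \<gamma> else 0) * \<gamma> h)"
      using A(1) B(1) by (intro sum.mono_neutral_cong_left) auto
    ultimately show ?thesis
      unfolding A(3) B(3) e_def by (simp only: plus_fun_apply of_int_add distrib_right sum.distrib)
  qed
  then have "\<alpha> + \<beta> = (\<lambda>h. \<Sum>\<gamma>\<in>A \<union> B. of_int (e \<gamma>) * \<gamma> h)" by (rule ext)
  then show ?thesis
    unfolding int_span_def using A(1,2) B(1,2) by (intro CollectI exI[of _ "A \<union> B"] exI[of _ e]) auto
qed

lemma int_span_scale:
  assumes "\<alpha> \<in> int_span S"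
  shows "(\<lambda>h. of_int n * \<alpha> h) \<in> int_span S"
proof -
  obtain A c where A: "finite A" "A \<subseteq> S" "\<alpha> = (\<lambda>h. \<Sum>\<gamma>\<in>A. of_int (c \<gamma>) * \<gamma> h)"
    using assms unfolding int_span_def by blast
  then have "(\<lambda>h. of_int n * \<alpha> h) = (\<lambda>h. \<Sum>\<gamma>\<in>A. of_int (n * c \<gamma>) * \<gamma> h)"
    by (simp add: sum_distrib_left mult.assoc)
  then show ?thesis
    unfolding int_span_def using A(1,2) by (intro CollectI exI[of _ A] exI[of _ "\<lambda>\<gamma>. n * c \<gamma>"]) auto
qed

lemma int_span_uminus: "\<alpha> \<in> int_span S \<Longrightarrow> - \<alpha> \<in> int_span S"
  using int_span_scale[of \<alpha> S "- 1"] by (simp add: fun_Compl_def)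

lemma int_span_minimal:
  assumes "S \<subseteq> int_span T"
  shows "int_span S \<subseteq> int_span T"
proof
  fix \<alpha> assume "\<alpha> \<in> int_span S"
  then obtain A c where A: "finite A" "A \<subseteq> S" "\<alpha> = (\<lambda>h. \<Sum>\<gamma>\<in>A. of_int (c \<gamma>) * \<gamma> h)"
    unfolding int_span_def by blast
  have "(\<lambda>h. \<Sum>\<gamma>\<in>A. of_int (c \<gamma>) * \<gamma> h) \<in> int_span T"
    using A(1,2)
  proof (induction A rule: finite_induct)
    case empty
    show ?case using int_span_zero by (simp add: zero_fun_def)
  next
    case (insert \<gamma> A)
    have "(\<lambda>h. of_int (c \<gamma>) * \<gamma> h) + (\<lambda>h. \<Sum>\<gamma>\<in>A. of_int (c \<gamma>) * \<gamma> h) \<in> int_span T"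
      using insert assms by (intro int_span_add int_span_scale) auto
    then show ?case using insert by (simp add: plus_fun_def)
  qed
  then show "\<alpha> \<in> int_span T" using A(3) by simp
qed

lemma int_span_eqI:
  assumes "T \<subseteq> S" "S \<subseteq> int_span T"
  shows "int_span T = int_span S"
proof
  show "int_span T \<subseteq> int_span S" using assms(1) int_span_base by (intro int_span_minimal) blast
  show "int_span S \<subseteq> int_span T" using assms(2) by (rule int_span_minimal)
qed

section \<open>Subalgebras containing H as closed sets of roots\<close>

definition weight_sum :: "('a \<Rightarrow> 'k) set \<Rightarrow> 'a set" where
  "weight_sum \<Psi> = span (\<Union>\<alpha>\<in>insert 0 \<Psi>. root_space H \<alpha>)"

text \<open>Stated through nonzero brackets, this is exactly the condition for
  \<open>weight_sum \<Psi>\<close> to be a subalgebra. Opposite roots are exempt because their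
  brackets lie in H.\<close>

definition bracket_closed :: "('a \<Rightarrow> 'k) set \<Rightarrow> bool" where
  "bracket_closed \<Psi> \<longleftrightarrow> (\<forall>\<alpha>\<in>\<Psi>. \<forall>\<beta>\<in>\<Psi>. \<forall>x\<in>root_space H \<alpha>. \<forall>y\<in>root_space H \<beta>.
     bracket x y \<noteq> 0 \<longrightarrow> \<alpha> + \<beta> \<noteq> 0 \<longrightarrow> \<alpha> + \<beta> \<in> \<Psi>)"

lemma bracket_closedD:
  "\<lbrakk>bracket_closed \<Psi>; \<alpha> \<in> \<Psi>; \<beta> \<in> \<Psi>; x \<in> root_space H \<alpha>; y \<in> root_space H \<beta>;
    bracket x y \<noteq> 0; \<alpha> + \<beta> \<noteq> 0\<rbrakk> \<Longrightarrow> \<alpha> + \<beta> \<in> \<Psi>"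
  unfolding bracket_closed_def by blast

lemma rootsD:
  assumes "\<alpha> \<in> roots H"
  shows "\<alpha> \<in> dual H" "\<alpha> \<noteq> 0" "\<exists>x\<in>root_space H \<alpha>. x \<noteq> 0"
  using assms subspace_0[OF subspace_root_space, of \<alpha>] by (auto simp: roots_def zero_fun_def)

text \<open>As H is its own centralizer, it is the weight space of 0; from here on it is treated as
  one more root space.\<close>

lemma component_eq_root_space: "component H \<alpha> = root_space H \<alpha>"
  using root_space_0 by (simp add: component_def zero_fun_def)

lemma is_direct_sum_root_spaces:
  assumes "\<Psi> \<subseteq> dual H"
  shows "is_direct_sum W \<Psi> (root_space H) \<longleftrightarrow> W = span (\<Union>\<alpha>\<in>\<Psi>. root_space H \<alpha>)"
proof -
  have "root_space H \<alpha> \<inter> span (\<Union>\<beta>\<in>\<Psi> - {\<alpha>}. root_space H \<beta>) = {0}" if "\<alpha> \<in> \<Psi>" for \<alpha>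
  proof
    show "root_space H \<alpha> \<inter> span (\<Union>\<beta>\<in>\<Psi> - {\<alpha>}. root_space H \<beta>) \<subseteq> {0}"
      using independent_family_Int_span[OF independent_family_root_space subspace_root_space, of "\<Psi> - {\<alpha>}" \<alpha>]
        assms that by blast
  qed (simp add: subspace_0[OF subspace_root_space] span_zero)
  then show ?thesis
    unfolding is_direct_sum_def using subspace_root_space by blast
qed

lemma root_decomposition_iff: "root_decomposition H L \<Psi> \<longleftrightarrow> \<Psi> \<subseteq> roots H \<and> L = weight_sum \<Psi>"
proof (cases "\<Psi> \<subseteq> roots H")
  case True
  have *: "component H = root_space H" by (rule ext) (rule component_eq_root_space)
  have "insert 0 \<Psi> \<subseteq> dual H" using True rootsD dual_zero by blast
  from is_direct_sum_root_spaces[OF this] show ?thesis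
    using True unfolding root_decomposition_def * weight_sum_def zero_fun_def[symmetric] by blast
qed (simp add: root_decomposition_def)

lemma root_space_subset_weight_sum: "\<alpha> \<in> insert 0 \<Psi> \<Longrightarrow> root_space H \<alpha> \<subseteq> weight_sum \<Psi>"
  unfolding weight_sum_def by (auto intro: span_base)

lemma weight_in_weight_sum:
  assumes "\<Psi> \<subseteq> roots H" "\<gamma> \<in> dual H" "x \<in> root_space H \<gamma>" "x \<in> weight_sum \<Psi>" "x \<noteq> 0"
  shows "\<gamma> \<in> insert 0 \<Psi>"
proof (rule ccontr)
  assume "\<gamma> \<notin> insert 0 \<Psi>"
  moreover have "insert 0 \<Psi> \<subseteq> dual H" using assms(1) rootsD dual_zero by blast
  ultimately have "x = 0"
    using independent_family_Int_span[OF independent_family_root_space subspace_root_space, of "insert 0 \<Psi>" \<gamma>]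
      assms unfolding weight_sum_def by blast
  then show False using assms by blast
qed

text \<open>Every root of \<open>\<Psi>\<close> owns a nonzero vector, whose weight is recognized
  inside the larger sum. This carries minimality from subalgebras over to sets of roots.\<close>

lemma weight_sum_subset_iff:
  assumes "\<Psi> \<subseteq> roots H" "\<Psi>' \<subseteq> roots H"
  shows "weight_sum \<Psi> \<subseteq> weight_sum \<Psi>' \<longleftrightarrow> \<Psi> \<subseteq> \<Psi>'"
proof
  assume L: "weight_sum \<Psi> \<subseteq> weight_sum \<Psi>'"
  show "\<Psi> \<subseteq> \<Psi>'"
  proof
    fix \<alpha> assume \<alpha>: "\<alpha> \<in> \<Psi>"
    then obtain x where x: "x \<in> root_space H \<alpha>" "x \<noteq> 0" using rootsD assms by blast
    then have "x \<in> weight_sum \<Psi>'" using \<alpha> L root_space_subset_weight_sum[of \<alpha> \<Psi>] by blast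
    then show "\<alpha> \<in> \<Psi>'" using weight_in_weight_sum[OF assms(2) _ x(1) _ x(2)] rootsD \<alpha> assms(1) by blast
  qed
next
  assume "\<Psi> \<subseteq> \<Psi>'"
  then show "weight_sum \<Psi> \<subseteq> weight_sum \<Psi>'"
    unfolding weight_sum_def by (intro span_mono) blast
qed

lemma bracket_span_subset:
  assumes "subspace W" "\<And>x y. x \<in> A \<Longrightarrow> y \<in> A \<Longrightarrow> bracket x y \<in> W" "x \<in> span A" "y \<in> span A"
  shows "bracket x y \<in> W"
  using assms(3)
proof (induction rule: span_induct_alt)
  case (step c x z)
  have "bracket x y \<in> W"
    using assms(4)
  proof (induction rule: span_induct_alt)
    case (step c y z)
    then show ?case
      using assms(1,2) \<open>x \<in> A\<close> by (simp add: bracket_simps subspace_add subspace_scale)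
  qed (simp add: bracket_simps subspace_0[OF assms(1)])
  then show ?case using step assms(1) by (simp add: bracket_simps subspace_add subspace_scale)
qed (simp add: bracket_simps subspace_0[OF assms(1)])

lemma subalgebra_weight_sum_iff:
  assumes \<Psi>: "\<Psi> \<subseteq> roots H"
  shows "subalgebra (weight_sum \<Psi>) \<longleftrightarrow> bracket_closed \<Psi>"
proof
  assume L: "subalgebra (weight_sum \<Psi>)"
  show "bracket_closed \<Psi>"
    unfolding bracket_closed_def
  proof (intro ballI impI)
    fix \<alpha> \<beta> x y
    assume a: "\<alpha> \<in> \<Psi>" "\<beta> \<in> \<Psi>" "x \<in> root_space H \<alpha>" "y \<in> root_space H \<beta>" "bracket x y \<noteq> 0" "\<alpha> + \<beta> \<noteq> 0"
    have "x \<in> weight_sum \<Psi>" "y \<in> weight_sum \<Psi>" using a root_space_subset_weight_sum by blast+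
    then have "bracket x y \<in> weight_sum \<Psi>" using L by (simp add: subalgebra_def)
    moreover have "\<alpha> + \<beta> \<in> dual H" by (intro dual_add rootsD(1) subsetD[OF \<Psi>] a)
    ultimately have "\<alpha> + \<beta> \<in> insert 0 \<Psi>"
      using weight_in_weight_sum[OF \<Psi>] bracket_root_space[OF a(3,4)] a(5) by blast
    then show "\<alpha> + \<beta> \<in> \<Psi>" using a(6) by blast
  qed
next
  assume closed: "bracket_closed \<Psi>"
  have "bracket x y \<in> weight_sum \<Psi>"
    if xy: "x \<in> (\<Union>\<alpha>\<in>insert 0 \<Psi>. root_space H \<alpha>)" "y \<in> (\<Union>\<alpha>\<in>insert 0 \<Psi>. root_space H \<alpha>)" for x y
  proof -
    obtain \<alpha> \<beta> where ab: "\<alpha> \<in> insert 0 \<Psi>" "\<beta> \<in> insert 0 \<Psi>" "x \<in> root_space H \<alpha>" "y \<in> root_space H \<beta>"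
      using xy by blast
    show ?thesis
    proof (cases "bracket x y = 0")
      case True
      then show ?thesis by (simp add: weight_sum_def span_zero)
    next
      case False
      have "\<alpha> + \<beta> \<in> insert 0 \<Psi>"
      proof (cases "\<alpha> = 0 \<or> \<beta> = 0")
        case True
        then show ?thesis using ab by auto
      next
        case nz: False
        then show ?thesis using bracket_closedD[OF closed _ _ ab(3,4) False] ab(1,2) by blast
      qed
      then show ?thesis using root_space_subset_weight_sum bracket_root_space[OF ab(3,4)] by blast
    qed
  qed
  then have "bracket x y \<in> weight_sum \<Psi>" if "x \<in> weight_sum \<Psi>" "y \<in> weight_sum \<Psi>" for x y
    using that bracket_span_subset[of "weight_sum \<Psi>"] unfolding weight_sum_def
    by (metis (no_types, lifting) subspace_span)
  then show "subalgebra (weight_sum \<Psi>)" by (simp add: subalgebra_def weight_sum_def)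
qed

lemma Q_graded_iff:
  "Q_graded H L \<longleftrightarrow>
    (\<exists>\<Psi>\<subseteq>roots H. L = weight_sum \<Psi> \<and> bracket_closed \<Psi> \<and> int_span \<Psi> = root_lattice H)"
proof -
  have "H \<subseteq> weight_sum \<Psi>" for \<Psi>
    using root_space_subset_weight_sum[of 0 \<Psi>] root_space_0 by simp
  then show ?thesis
    unfolding Q_graded_def root_decomposition_iff using subalgebra_weight_sum_iff by blast
qed

text \<open>The roots are finitely many nonzero vectors in a rational vector space of functions. The
  sign of f separates each root from its negative and so serves as a choice of positive
  roots.\<close>

lemma ex_additive_nonzero_on_roots:
  "\<exists>f :: ('a \<Rightarrow> 'k) \<Rightarrow> rat. (\<forall>\<alpha> \<beta>. f (\<alpha> + \<beta>) = f \<alpha> + f \<beta>) \<and> (\<forall>\<alpha>. f (- \<alpha>) = - f \<alpha>) \<and>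
    (\<forall>\<alpha>\<in>roots H. f \<alpha> \<noteq> 0)"
proof -
  interpret V: vector_space "\<lambda>q (g :: 'a \<Rightarrow> 'k) h. of_rat q * g h"
    by unfold_locales (simp_all add: fun_eq_iff algebra_simps of_rat_add of_rat_mult)
  have "0 \<notin> roots H" using rootsD by blast
  then obtain f :: "('a \<Rightarrow> 'k) \<Rightarrow> rat" where f: "\<forall>x y. f (x + y) = f x + f y" "\<forall>\<alpha>\<in>roots H. f \<alpha> \<noteq> 0"
    using V.ex_linear_functional_nonzero[OF infinite_UNIV_char_0 finite_roots] by blast
  have "f 0 = 0" using f(1) by (metis add_cancel_right_right)
  then have "f (- \<alpha>) = - f \<alpha>" for \<alpha>
    using f(1) by (metis add.right_inverse add_eq_0_iff)
  then show ?thesis using f by blast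
qed

section \<open>Shrinking a closed set of roots without changing its integer span\<close>

context
  fixes \<Psi>
  assumes \<Psi>: "\<Psi> \<subseteq> roots H" and closed: "bracket_closed \<Psi>"
begin

lemma \<Psi>_weight: "\<alpha> \<in> \<Psi> \<Longrightarrow> \<alpha> \<in> dual H" "\<alpha> \<in> \<Psi> \<Longrightarrow> \<alpha> \<noteq> 0" "\<alpha> \<in> \<Psi> \<Longrightarrow> \<exists>x\<in>root_space H \<alpha>. x \<noteq> 0"
  using \<Psi> rootsD by blast+

text \<open>Some z of weight -(\<alpha> + \<beta>) pairs nontrivially with [x, y]. By invariance x
  pairs nontrivially with [y, z], so this bracket of weight -\<alpha> is nonzero and closure applies
  to it.\<close>

lemma uminus_mem_of_bracket_nonzero:
  assumes "\<alpha> \<in> \<Psi>" "\<beta> \<in> \<Psi>" "x \<in> root_space H \<alpha>" "y \<in> root_space H \<beta>" "bracket x y \<noteq> 0"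
    and "- (\<alpha> + \<beta>) \<in> \<Psi>"
  shows "- \<alpha> \<in> \<Psi>"
proof -
  have "\<alpha> + \<beta> \<in> dual H" using assms \<Psi>_weight dual_add by blast
  then obtain z where z: "z \<in> root_space H (- (\<alpha> + \<beta>))" "killing (bracket x y) z \<noteq> 0"
    using ex_killing_dual[OF _ bracket_root_space[OF assms(3,4)] assms(5)] by blast
  then have "bracket y z \<noteq> 0" by (auto simp: killing_invariant killing_simps)
  moreover have "\<beta> + - (\<alpha> + \<beta>) = - \<alpha>" by simp
  ultimately show ?thesis
    using bracket_closedD[OF closed assms(2,6,4) z(1)] \<Psi>_weight(2)[OF assms(1)] by simp
qed

text \<open>If a bracket weight falls into the symmetric part of \<open>\<Psi>\<close>, the
  preceding lemma puts both summands there; both are then positive, and so is the sum. A discarded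
  root is the negative of a kept one, and \<alpha> and -\<alpha> are not both kept.\<close>

lemma ex_smaller_generating_of_opposite:
  assumes "\<alpha> \<in> \<Psi>" "- \<alpha> \<in> \<Psi>"
  shows "\<exists>\<Psi>'\<subset>\<Psi>. bracket_closed \<Psi>' \<and> int_span \<Psi>' = int_span \<Psi>"
proof -
  obtain f :: "('a \<Rightarrow> 'k) \<Rightarrow> rat" where f: "\<And>\<alpha> \<beta>. f (\<alpha> + \<beta>) = f \<alpha> + f \<beta>" "\<And>\<alpha>. f (- \<alpha>) = - f \<alpha>"
    "\<And>\<alpha>. \<alpha> \<in> roots H \<Longrightarrow> f \<alpha> \<noteq> 0"
    using ex_additive_nonzero_on_roots by blast
  let ?\<Psi>' = "{\<beta> \<in> \<Psi>. - \<beta> \<in> \<Psi> \<longrightarrow> f \<beta> > 0}"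
  have "bracket_closed ?\<Psi>'"
    unfolding bracket_closed_def
  proof (intro ballI impI)
    fix \<beta> \<gamma> x y
    assume a: "\<beta> \<in> ?\<Psi>'" "\<gamma> \<in> ?\<Psi>'" "x \<in> root_space H \<beta>" "y \<in> root_space H \<gamma>" "bracket x y \<noteq> 0" "\<beta> + \<gamma> \<noteq> 0"
    have "\<beta> + \<gamma> \<in> \<Psi>" using a bracket_closedD[OF closed] by blast
    moreover have "f (\<beta> + \<gamma>) > 0" if neg: "- (\<beta> + \<gamma>) \<in> \<Psi>"
    proof -
      have "- \<beta> \<in> \<Psi>" using uminus_mem_of_bracket_nonzero[OF _ _ a(3,4,5) neg] a(1,2) by blast
      moreover have "bracket y x \<noteq> 0" using a(5) bracket_eq_0_commute by blast
      then have "- \<gamma> \<in> \<Psi>"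
        using uminus_mem_of_bracket_nonzero[OF _ _ a(4,3)] neg a(1,2) by (simp add: add.commute)
      ultimately show ?thesis using a(1,2) by (simp add: f(1))
    qed
    ultimately show "\<beta> + \<gamma> \<in> ?\<Psi>'" by blast
  qed
  moreover have "\<Psi> \<subseteq> int_span ?\<Psi>'"
  proof
    fix \<beta> assume \<beta>: "\<beta> \<in> \<Psi>"
    show "\<beta> \<in> int_span ?\<Psi>'"
    proof (cases "\<beta> \<in> ?\<Psi>'")
      case False
      then have "- \<beta> \<in> \<Psi>" "f (- \<beta>) > 0" using \<beta> f(2) f(3)[of \<beta>] \<Psi> by auto
      then have "- \<beta> \<in> int_span ?\<Psi>'" by (intro int_span_base) simp
      then show ?thesis using int_span_uminus[of "- \<beta>"] by simp
    qed (rule int_span_base)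
  qed
  then have "int_span ?\<Psi>' = int_span \<Psi>" by (intro int_span_eqI) auto
  moreover have "?\<Psi>' \<noteq> \<Psi>"
  proof
    assume "?\<Psi>' = \<Psi>"
    then have "\<alpha> \<in> ?\<Psi>'" "- \<alpha> \<in> ?\<Psi>'" using assms by (simp_all only:)
    then have "f \<alpha> > 0" "f (- \<alpha>) > 0" using assms by simp_all
    then show False using f(2) by simp
  qed
  ultimately show ?thesis by (intro exI[of _ ?\<Psi>']) auto
qed

context
  assumes no_opposite: "\<And>\<alpha>. \<alpha> \<in> \<Psi> \<Longrightarrow> - \<alpha> \<notin> \<Psi>"
begin

lemma sum_nonzero_of_no_opposite:
  assumes "\<alpha> \<in> \<Psi>" "\<beta> \<in> \<Psi>"
  shows "\<alpha> + \<beta> \<noteq> 0"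
proof
  assume "\<alpha> + \<beta> = 0"
  then have "\<beta> = - \<alpha>" by (simp add: eq_neg_iff_add_eq_0 add.commute)
  then show False using no_opposite assms by blast
qed

lemma sum_mset_nonzero:
  assumes "set_mset M \<subseteq> \<Psi>" "M \<noteq> {#}"
  shows "sum_mset M \<noteq> 0"
  using assms
proof (induction "size M" arbitrary: M rule: less_induct)
  case less
  show ?case
  proof (cases "\<exists>\<beta> \<gamma> N x y. M = add_mset \<beta> (add_mset \<gamma> N) \<and> x \<in> root_space H \<beta> \<and> y \<in> root_space H \<gamma> \<and> bracket x y \<noteq> 0")
    case True
    then obtain \<beta> \<gamma> N x y where M: "M = add_mset \<beta> (add_mset \<gamma> N)"
      and xy: "x \<in> root_space H \<beta>" "y \<in> root_space H \<gamma>" "bracket x y \<noteq> 0" by blast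
    have bc: "\<beta> \<in> \<Psi>" "\<gamma> \<in> \<Psi>" using less.prems M by auto
    have "\<beta> + \<gamma> \<in> \<Psi>" using bracket_closedD[OF closed bc xy] sum_nonzero_of_no_opposite[OF bc] by blast
    then have "sum_mset (add_mset (\<beta> + \<gamma>) N) \<noteq> 0"
      using less.prems M by (intro less.hyps) auto
    then show ?thesis by (simp add: M add.assoc)
  next
    case False
    then have commuting: "bracket x y = 0"
      if "M = add_mset \<beta> (add_mset \<gamma> N)" "x \<in> root_space H \<beta>" "y \<in> root_space H \<gamma>" for \<beta> \<gamma> N x y
      using that by blast
    obtain \<alpha> where \<alpha>: "\<alpha> \<in># M" using less.prems(2) by blast
    then have \<alpha>\<Psi>: "\<alpha> \<in> \<Psi>" using less.prems by blast
    note \<alpha>w = \<Psi>_weight(1,2)[OF \<alpha>\<Psi>]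
    obtain x where x: "x \<in> root_space H \<alpha>" "x \<noteq> 0" using \<Psi>_weight(3)[OF \<alpha>\<Psi>] by blast
    obtain y where y: "y \<in> root_space H (- \<alpha>)" "killing x y \<noteq> 0"
      using ex_killing_dual[OF \<alpha>w(1) x] by blast
    let ?h = "bracket x y"
    have \<alpha>h: "\<alpha> ?h \<noteq> 0" by (rule root_coroot_nonzero[OF \<alpha>w x(1) y])
    have "\<exists>k::nat. 2 * \<beta> ?h = \<alpha> ?h * of_nat k" if \<beta>: "\<beta> \<in># M" for \<beta>
    proof -
      have \<beta>\<Psi>: "\<beta> \<in> \<Psi>" using \<beta> less.prems by blast
      obtain v where v: "v \<in> root_space H \<beta>" "v \<noteq> 0" using \<Psi>_weight(3)[OF \<beta>\<Psi>] by blast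
      have "bracket x v = 0"
      \<comment> \<open>\<open>commuting\<close> speaks of two separate occurrences in M, and
        \<alpha> may occur only once; for \<beta> = \<alpha> the vectors commute because the root
        space is one-dimensional.\<close>
      proof (cases "\<beta> = \<alpha>")
        case True
        then show ?thesis using root_space_abelian[OF \<alpha>w x(1)] v(1) by blast
      next
        case False
        obtain N where N: "M = add_mset \<alpha> N" using \<alpha> by (auto dest: multi_member_split)
        then have "\<beta> \<in># N" using \<beta> False by simp
        then obtain N' where "N = add_mset \<beta> N'" by (auto dest: multi_member_split)
        then have "M = add_mset \<alpha> (add_mset \<beta> N')" using N by simp
        then show ?thesis using commuting x(1) v(1) by blast
      qed
      then show ?thesis
        using highest_weight_root[OF \<alpha>w x(1) y \<Psi>_weight(1)[OF \<beta>\<Psi>] v] by blast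
    qed
    then obtain k :: "('a \<Rightarrow> 'k) \<Rightarrow> nat" where k: "\<And>\<beta>. \<beta> \<in># M \<Longrightarrow> 2 * \<beta> ?h = \<alpha> ?h * of_nat (k \<beta>)"
      by metis
    have sum: "2 * sum_mset N ?h = \<alpha> ?h * of_nat (\<Sum>\<beta>\<in>#N. k \<beta>)" if "N \<subseteq># M" for N
      using that
    proof (induction N)
      case (add \<beta> N)
      then have "\<beta> \<in># M" "N \<subseteq># M" using mset_subset_eqD subset_mset.dual_order.trans by fastforce+
      then show ?case using add.IH k[of \<beta>] by (simp add: distrib_left)
    qed simp
    show ?thesis
    proof
      assume "sum_mset M = 0"
      \<comment> \<open>In characteristic 0 the natural number itself is 0, hence so is each
        \<open>k \<beta>\<close>; but \<alpha> takes the value 2 on its own coroot.\<close>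
      then have "of_nat (\<Sum>\<beta>\<in>#M. k \<beta>) = (0 :: 'k)" using sum[of M] \<alpha>h by simp
      then have "(\<Sum>\<beta>\<in>#M. k \<beta>) = 0" by (simp only: of_nat_eq_0_iff)
      then have "k \<alpha> = 0" using \<alpha> by (simp add: sum_mset_0_iff)
      then show False using k[OF \<alpha>] \<alpha>h by simp
    qed
  qed
qed

lemma ex_smaller_generating_of_bracket_nonzero:
  assumes "\<alpha> \<in> \<Psi>" "\<beta> \<in> \<Psi>" "x \<in> root_space H \<alpha>" "y \<in> root_space H \<beta>" "bracket x y \<noteq> 0"
  shows "\<exists>\<Psi>'\<subset>\<Psi>. bracket_closed \<Psi>' \<and> int_span \<Psi>' = int_span \<Psi>"
proof -
  \<comment> \<open>\<beta> is placed below \<beta> + \<delta>. Along a chain the difference is a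
    nonempty sum of elements of \<open>\<Psi>\<close>, so a cycle would be a vanishing sum, and
    finiteness turns acyclicity into well-foundedness.\<close>
  define R where "R = {(\<beta>, \<gamma>). \<beta> \<in> \<Psi> \<and> \<gamma> \<in> \<Psi> \<and> (\<exists>\<delta>\<in>\<Psi>. \<gamma> = \<beta> + \<delta>)}"
  have "finite \<Psi>" using \<Psi> finite_roots finite_subset by blast
  then have "finite (\<Psi> \<times> \<Psi>)" by simp
  moreover have "R \<subseteq> \<Psi> \<times> \<Psi>" by (auto simp: R_def)
  ultimately have finR: "finite R" by (rule finite_subset[rotated])
  have chain: "\<exists>M. set_mset M \<subseteq> \<Psi> \<and> M \<noteq> {#} \<and> \<gamma> = \<beta> + sum_mset M" if "(\<beta>, \<gamma>) \<in> R\<^sup>+" for \<beta> \<gamma>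
    using that
  proof (induction rule: trancl_induct)
    case (base \<gamma>)
    then obtain \<delta> where "\<delta> \<in> \<Psi>" "\<gamma> = \<beta> + \<delta>" by (auto simp: R_def)
    then show ?case by (intro exI[of _ "{#\<delta>#}"]) simp
  next
    case (step \<gamma> \<epsilon>)
    then obtain \<delta> where \<delta>: "\<delta> \<in> \<Psi>" "\<epsilon> = \<gamma> + \<delta>" by (auto simp: R_def)
    from step obtain M where "set_mset M \<subseteq> \<Psi>" "\<gamma> = \<beta> + sum_mset M" by blast
    then show ?case using \<delta> by (intro exI[of _ "add_mset \<delta> M"]) (simp add: ac_simps)
  qed
  have "acyclic R"
    unfolding acyclic_def
  proof (intro allI notI)
    fix \<beta> assume "(\<beta>, \<beta>) \<in> R\<^sup>+"
    then obtain M where "set_mset M \<subseteq> \<Psi>" "M \<noteq> {#}" "\<beta> = \<beta> + sum_mset M" using chain by blast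
    then show False using sum_mset_nonzero[of M] by (metis add_cancel_right_right)
  qed
  with finR have wf: "wf R" by (rule finite_acyclic_wf)
  define D where "D = {\<gamma> \<in> \<Psi>. \<exists>\<alpha>\<in>\<Psi>. \<exists>\<beta>\<in>\<Psi>. \<exists>x\<in>root_space H \<alpha>. \<exists>y\<in>root_space H \<beta>.
      bracket x y \<noteq> 0 \<and> \<gamma> = \<alpha> + \<beta>}"
  have sum_in: "\<alpha> + \<beta> \<in> D"
    if "\<alpha> \<in> \<Psi>" "\<beta> \<in> \<Psi>" "x \<in> root_space H \<alpha>" "y \<in> root_space H \<beta>" "bracket x y \<noteq> 0" for \<alpha> \<beta> x y
    unfolding D_def using that bracket_closedD[OF closed that] sum_nonzero_of_no_opposite[OF that(1,2)]
    by blast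
  then have "\<alpha> + \<beta> \<in> D" using assms by blast
  then obtain \<gamma> where \<gamma>: "\<gamma> \<in> D" and min: "\<And>\<delta>. (\<delta>, \<gamma>) \<in> R \<Longrightarrow> \<delta> \<notin> D"
    using wfE_min[OF wf, of "\<alpha> + \<beta>" D] by blast
  from \<gamma> obtain \<alpha> \<beta> x y where a: "\<alpha> \<in> \<Psi>" "\<beta> \<in> \<Psi>" "x \<in> root_space H \<alpha>" "y \<in> root_space H \<beta>"
    "bracket x y \<noteq> 0" "\<gamma> = \<alpha> + \<beta>" "\<gamma> \<in> \<Psi>"
    unfolding D_def by blast
  have "(\<alpha>, \<gamma>) \<in> R" using a by (auto simp: R_def)
  then have \<alpha>D: "\<alpha> \<notin> D" by (rule min)
  let ?\<Psi>' = "\<Psi> - {\<alpha>}"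
  have "bracket_closed ?\<Psi>'"
    unfolding bracket_closed_def
  proof (intro ballI impI)
    fix \<delta> \<epsilon> u v
    assume "\<delta> \<in> ?\<Psi>'" "\<epsilon> \<in> ?\<Psi>'" "u \<in> root_space H \<delta>" "v \<in> root_space H \<epsilon>" "bracket u v \<noteq> 0"
    then have "\<delta> + \<epsilon> \<in> D" using sum_in by blast
    then show "\<delta> + \<epsilon> \<in> ?\<Psi>'" using \<alpha>D unfolding D_def by blast
  qed
  moreover have "int_span ?\<Psi>' = int_span \<Psi>"
  proof (rule int_span_eqI)
    have "\<beta> \<noteq> \<alpha>"
      using root_space_abelian[OF \<Psi>_weight(1)[OF a(1)] \<Psi>_weight(2)[OF a(1)] a(3)] a(4,5) by blast
    moreover have "\<gamma> \<noteq> \<alpha>" using a(6) \<Psi>_weight(2)[OF a(2)] by simp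
    ultimately have "\<gamma> + - \<beta> \<in> int_span ?\<Psi>'"
      using a by (intro int_span_add int_span_uminus int_span_base) auto
    then have "\<alpha> \<in> int_span ?\<Psi>'" using a(6) by (simp add: algebra_simps)
    moreover have "\<delta> \<in> int_span ?\<Psi>'" if "\<delta> \<in> \<Psi>" "\<delta> \<noteq> \<alpha>" for \<delta>
      using that by (intro int_span_base) simp
    ultimately show "\<Psi> \<subseteq> int_span ?\<Psi>'" by blast
  qed blast
  ultimately show ?thesis using a(1) by (intro exI[of _ ?\<Psi>']) auto
qed

end

end

section \<open>Consequences for minimal Q-graded subalgebras\<close>

lemma minimal_Q_graded_bracket_eq_0:
  assumes min: "minimal_Q_graded H L" and dec: "root_decomposition H L \<Psi>"
    and "\<alpha> \<in> \<Psi>" "\<beta> \<in> \<Psi>" "x \<in> root_space H \<alpha>" "y \<in> root_space H \<beta>"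
  shows "bracket x y = 0"
proof -
  have \<Psi>: "\<Psi> \<subseteq> roots H" and L: "L = weight_sum \<Psi>" using dec by (auto simp: root_decomposition_iff)
  have "Q_graded H L" using min by (simp add: minimal_Q_graded_def)
  \<comment> \<open>\<open>Q_graded\<close> supplies some set of roots for L, a priori unrelated to
    the given \<open>\<Psi>\<close>; since \<open>weight_sum\<close> determines its set of roots,
    the two agree.\<close>
  then obtain \<Psi>0 where "\<Psi>0 \<subseteq> roots H" "L = weight_sum \<Psi>0" "bracket_closed \<Psi>0" "int_span \<Psi>0 = root_lattice H"
    unfolding Q_graded_iff by blast
  moreover from this have "\<Psi>0 = \<Psi>" using weight_sum_subset_iff[of \<Psi> \<Psi>0] weight_sum_subset_iff[of \<Psi>0 \<Psi>] \<Psi> L by blast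
  ultimately have closed: "bracket_closed \<Psi>" and lattice: "int_span \<Psi> = root_lattice H" by auto
  have minimal: False if "\<Psi>' \<subset> \<Psi>" "bracket_closed \<Psi>'" "int_span \<Psi>' = int_span \<Psi>" for \<Psi>'
  proof -
    have \<Psi>': "\<Psi>' \<subseteq> roots H" using that \<Psi> by blast
    then have "Q_graded H (weight_sum \<Psi>')" unfolding Q_graded_iff using that lattice by blast
    moreover have "weight_sum \<Psi>' \<subset> L"
      unfolding L using weight_sum_subset_iff[OF \<Psi> \<Psi>'] weight_sum_subset_iff[OF \<Psi>' \<Psi>] that(1) by blast
    ultimately show False using min unfolding minimal_Q_graded_def by blast
  qed
  have "- \<gamma> \<notin> \<Psi>" if "\<gamma> \<in> \<Psi>" for \<gamma>
    using ex_smaller_generating_of_opposite[OF \<Psi> closed that] minimal by blast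
  then show ?thesis
    using ex_smaller_generating_of_bracket_nonzero[OF \<Psi> closed _ assms(3-6)] minimal by blast
qed

text \<open>[H, H] and all brackets between root spaces of \<open>\<Psi>\<close> vanish, so only the
  brackets of H with root spaces contribute to [L, L]. They give whole root spaces: x =
  [h, x]/\<alpha>(h) for some h with \<alpha>(h) nonzero.\<close>

lemma minimal_Q_graded_metabelian:
  assumes min: "minimal_Q_graded H L" and dec: "root_decomposition H L \<Psi>"
  shows "is_direct_sum (commutator L L) \<Psi> (root_space H) \<and> abelian (commutator L L) \<and> metabelian L"
proof -
  have \<Psi>: "\<Psi> \<subseteq> roots H" and L: "L = weight_sum \<Psi>" using dec by (auto simp: root_decomposition_iff)
  note zero = minimal_Q_graded_bracket_eq_0[OF min dec]
  let ?I = "span (\<Union>\<alpha>\<in>\<Psi>. root_space H \<alpha>)"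
  have gen: "bracket x y \<in> ?I"
    if xy: "x \<in> (\<Union>\<alpha>\<in>insert 0 \<Psi>. root_space H \<alpha>)" "y \<in> (\<Union>\<alpha>\<in>insert 0 \<Psi>. root_space H \<alpha>)" for x y
  proof -
    obtain \<alpha> \<beta> where ab: "\<alpha> \<in> insert 0 \<Psi>" "\<beta> \<in> insert 0 \<Psi>" "x \<in> root_space H \<alpha>" "y \<in> root_space H \<beta>"
      using xy by blast
    have xy': "bracket x y \<in> root_space H (\<alpha> + \<beta>)" by (rule bracket_root_space[OF ab(3,4)])
    consider "\<alpha> = 0" "\<beta> = 0" | "\<alpha> = 0" "\<beta> \<in> \<Psi>" | "\<alpha> \<in> \<Psi>" "\<beta> = 0" | "\<alpha> \<in> \<Psi>" "\<beta> \<in> \<Psi>"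
      using ab(1,2) by blast
    then show ?thesis
    proof cases
      case 1
      then have "bracket x y = 0" using ab(3,4) root_space_0 H_abelian by simp
      then show ?thesis by (simp add: span_zero)
    next
      case 4
      then have "bracket x y = 0" using zero ab by blast
      then show ?thesis by (simp add: span_zero)
    qed (use xy' in \<open>auto intro!: span_base\<close>)
  qed
  have "bracket x y \<in> ?I" if "x \<in> L" "y \<in> L" for x y
    by (rule bracket_span_subset[OF subspace_span gen]) (use that L weight_sum_def in auto)
  then have "commutator L L \<subseteq> ?I"
    unfolding commutator_def by (intro span_minimal) auto
  moreover have "root_space H \<alpha> \<subseteq> commutator L L" if \<alpha>: "\<alpha> \<in> \<Psi>" for \<alpha>
  proof
    fix x assume x: "x \<in> root_space H \<alpha>"
    obtain h where h: "h \<in> H" "\<alpha> h \<noteq> 0"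
      using dual_eqI[OF _ dual_zero, of \<alpha>] rootsD(1,2) \<alpha> \<Psi> by (metis subsetD zero_fun_apply)
    have "h \<in> L" "x \<in> L"
      using h(1) x \<alpha> L root_space_0 root_space_subset_weight_sum[of _ \<Psi>] by blast+
    then have "bracket h x \<in> commutator L L"
      unfolding commutator_def by (intro span_base) blast
    then have "inverse (\<alpha> h) *s bracket h x \<in> commutator L L"
      unfolding commutator_def by (rule span_scale)
    then show "x \<in> commutator L L" using h root_spaceD[OF x h(1)] by simp
  qed
  then have "?I \<subseteq> commutator L L"
    unfolding commutator_def[of L L] by (intro span_minimal) auto
  ultimately have I: "commutator L L = ?I" by blast
  have "bracket x y \<in> {0}" if "x \<in> ?I" "y \<in> ?I" for x y
    by (rule bracket_span_subset[OF subspace_single_0 _ that]) (use zero in blast)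
  then have ab: "abelian (commutator L L)" unfolding abelian_def I by blast
  have "commutator ?I ?I \<subseteq> {0}"
    unfolding commutator_def by (intro span_minimal) (use ab I abelian_def in auto)
  moreover have "0 \<in> commutator ?I ?I" unfolding commutator_def by (rule span_zero)
  ultimately have "commutator ?I ?I = {0}" by blast
  then have "metabelian L" by (simp add: metabelian_def numeral_2_eq_2 I)
  moreover have "is_direct_sum (commutator L L) \<Psi> (root_space H)"
    using is_direct_sum_root_spaces[of \<Psi>] \<Psi> rootsD I by blast
  ultimately show ?thesis using ab by blast
qed

end

theorem theorem2p4:
  fixes scale :: "'k::{alg_closed_field, field_char_0} \<Rightarrow> 'a::ab_group_add \<Rightarrow> 'a"
    and bracket :: "'a \<Rightarrow> 'a \<Rightarrow> 'a"
    and H L :: "'a set"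
    and \<Psi> :: "('a \<Rightarrow> 'k) set"
  assumes "semisimple_lie_algebra scale bracket"
    and "lie_algebra.maximal_torus scale bracket H"
    and "lie_algebra.minimal_Q_graded scale bracket H L"
    and "lie_algebra.root_decomposition scale bracket H L \<Psi>"
  shows "lie_algebra.is_direct_sum scale (lie_algebra.commutator scale bracket L L)
           \<Psi> (lie_algebra.root_space scale bracket H) \<and>
         lie_algebra.abelian bracket (lie_algebra.commutator scale bracket L L) \<and>
         lie_algebra.metabelian scale bracket L"
proof -
  interpret semisimple_lie_algebra scale bracket by fact
  interpret semisimple_with_torus scale bracket H by unfold_locales fact
  show ?thesis using assms(3,4) by (rule minimal_Q_graded_metabelian)
qed

end
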